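(* Let $\mathcal A\subseteq\mathbb N$, $L$ an environment and $T$ a term. If $L\vdash_{\mathcal A}T$, then there exists a term $U$ such that $L\vdash_{\mathcal A}T:U$.
   Context: Fix a nonempty set $\Sigma$ of sorts with decidable equality, an arbitrary function $\mathrm{next}:\Sigma\to\Sigma$, and a countably infinite set of variables. Terms and environments: $T,U,V,W ::= \star s \mid x \mid \mathrm{app}(V,T) \mid \lambda x{:}W.\,T \mid \mathrm{def}(x{=}V).\,T \mid \mathrm{cast}(U,T)$ ($s\in\Sigma$) and $L,K ::= \emptyset \mid K,x{:}W \mid K,x{=}V$. $\mathrm{app}(V,T)$ applies $T$ to $V$; $\lambda x{:}W.\,T$ (de Bruijn's abstraction) and $\mathrm{def}(x{=}V).\,T$ (local definition) bind $x$ in $T$; $\mathrm{cast}(U,T)$ annotates $T$ with expected type $U$; entries $x{:}W$ and $x{=}V$ bind $x$. Terms are modulo renaming of bound variables. Write $\mathsf{B}x[V]$ for either $\lambda x{:}V$ or $\mathrm{def}(x{=}V)$ and correspondingly $L,x[V]$ for $L,x{:}V$ resp. $L,x{=}V$. One step of bound rt-reduction $L\vdash T_1\to^nT_2$ is the smallest relation closed under: $L\vdash\mathrm{app}(V,\lambda x{:}W.\,T)\to^0\mathrm{def}(x{=}\mathrm{cast}(W,V)).\,T$; $K,x{=}V\vdash x\to^0V$; $L\vdash\mathrm{def}(x{=}V).\,T\to^0T$ if $x$ not free in $T$; $L\vdash\mathrm{app}(V,\mathrm{def}(x{=}W).\,T)\to^0\mathrm{def}(x{=}W).\,\mathrm{app}(V,T)$;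 $L\vdash\mathrm{cast}(U,T)\to^0T$; $L\vdash\star s\to^1\star\,\mathrm{next}(s)$; $K,x{:}W\vdash x\to^1W$; $L\vdash\mathrm{cast}(U,T)\to^1U$; if $K\vdash x\to^nT$, $y\neq x$, $y$ not free in $T$ then $K,y[V]\vdash x\to^nT$; if $L\vdash V_1\to^0V_2$ then $L\vdash\mathrm{app}(V_1,T)\to^0\mathrm{app}(V_2,T)$; if $L\vdash T_1\to^nT_2$ then $L\vdash\mathrm{app}(V,T_1)\to^n\mathrm{app}(V,T_2)$; if $L\vdash V_1\to^0V_2$ then $L\vdash\mathsf Bx[V_1].\,T\to^0\mathsf Bx[V_2].\,T$; if $L,x[V]\vdash T_1\to^nT_2$ then $L\vdash\mathsf Bx[V].\,T_1\to^n\mathsf Bx[V].\,T_2$; if $L\vdash U_1\to^0U_2$ then $L\vdash\mathrm{cast}(U_1,T)\to^0\mathrm{cast}(U_2,T)$; if $L\vdash T_1\to^0T_2$ then $L\vdash\mathrm{cast}(U,T_1)\to^0\mathrm{cast}(U,T_2)$; if $L\vdash U_1\to^1U_2$ and $L\vdash T_1\to^1T_2$ then $L\vdash\mathrm{cast}(U_1,T_1)\to^1\mathrm{cast}(U_2,T_2)$. $L\vdash T_1\to^{*n}T_2$ is the smallest relation with $L\vdash T\to^{*0}T$, containing single steps, and with $L\vdash T_1\to^{*n_1}T$, $L\vdash T\to^{*n_2}T_2$ implying $L\vdash T_1\to^{*n_1+n_2}T_2$. Validity $L\vdash_{\mathcal A}T$ is the smallest predicate closed under: $L\vdash_{\mathcal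 A}\star s$; if $K\vdash_{\mathcal A}V$ then $K,x[V]\vdash_{\mathcal A}x$; if $K\vdash_{\mathcal A}x$ and $y\neq x$ then $K,y[V]\vdash_{\mathcal A}x$; if $L\vdash_{\mathcal A}V$ and $L,x[V]\vdash_{\mathcal A}T$ then $L\vdash_{\mathcal A}\mathsf Bx[V].\,T$; if $L\vdash_{\mathcal A}U$, $L\vdash_{\mathcal A}T$ and some $U_0$ satisfies $L\vdash T\to^{*1}U_0$, $L\vdash U\to^{*0}U_0$, then $L\vdash_{\mathcal A}\mathrm{cast}(U,T)$; if $L\vdash_{\mathcal A}V$, $L\vdash_{\mathcal A}T$ and there are $n\in\mathcal A$, $x,W_0,U_0$ with $L\vdash T\to^{*n}\lambda x{:}W_0.\,U_0$ and $L\vdash V\to^{*1}W_0$, then $L\vdash_{\mathcal A}\mathrm{app}(V,T)$. The type judgment $L\vdash_{\mathcal A}T:U$ means $L\vdash_{\mathcal A}\mathrm{cast}(U,T)$. *)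

theory Defs
  imports Main
begin

text \<open>
  Terms modulo renaming of bound variables are represented with de Bruijn indices:
  \<open>Var i\<close> refers to the \<open>i\<close>-th enclosing binder, counting from the innermost one and
  continuing into the environment.  Indices beyond the environment are variables that it
  does not declare.
\<close>

datatype bkind = Dec  \<comment> \<open>\<open>x : W\<close>\<close> | Def  \<comment> \<open>\<open>x = V\<close>\<close>

datatype 's trm =
    Sort 's
  | Var nat
  | App "'s trm" "'s trm"  \<comment> \<open>\<open>App V T\<close> applies \<open>T\<close> to \<open>V\<close>\<close>
  | Bind bkind "'s trm" "'s trm"  \<comment> \<open>binds index 0 in the second term only\<close>
  | Cast "'s trm" "'s trm"  \<comment> \<open>\<open>Cast U T\<close> annotates \<open>T\<close> with the expected type \<open>U\<close>\<close>

abbreviation Lam :: "'s trm \<Rightarrow> 's trm \<Rightarrow> 's trm" where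
  "Lam \<equiv> Bind Dec"

abbreviation LDef :: "'s trm \<Rightarrow> 's trm \<Rightarrow> 's trm" where
  "LDef \<equiv> Bind Def"

text \<open>
  The head of the list is the most recent (rightmost) entry: \<open>K, x[V]\<close> is \<open>(b, V) # K\<close>.
  The term of an entry lives in the tail \<open>K\<close>.
\<close>

type_synonym 's env = "(bkind \<times> 's trm) list"

text \<open>
  \<open>lift c T\<close> makes room for a fresh variable at index \<open>c\<close>.  The terms in which index 0
  is not free are exactly those of the form \<open>lift 0 T\<close>, and \<open>T\<close> is then the same term
  seen outside the scope of that variable.
\<close>

primrec lift :: "nat \<Rightarrow> 's trm \<Rightarrow> 's trm" where
  "lift c (Sort s) = Sort s"
| "lift c (Var i) = Var (if i < c then i else Suc i)"
| "lift c (App V T) = App (lift c V) (lift c T)"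
| "lift c (Bind b V T) = Bind b (lift c V) (lift (Suc c) T)"
| "lift c (Cast U T) = Cast (lift c U) (lift c T)"

text \<open>
  \<open>rt_step nxt L n T1 T2\<close> is one step \<open>L \<turnstile> T1 \<rightarrow>\<^sup>n T2\<close> of bound rt-reduction, where
  \<open>nxt\<close> is the function on sorts.  In rule \<open>zeta\<close> the proviso that the variable is not free
  in the body is expressed by \<open>lift 0 T\<close>; in \<open>delta\<close>, \<open>theta\<close>, \<open>decl\<close> and \<open>weaken\<close> the
  lifting moves a term under one more binder.
\<close>

inductive rt_step ::
  "('s \<Rightarrow> 's) \<Rightarrow> 's env \<Rightarrow> nat \<Rightarrow> 's trm \<Rightarrow> 's trm \<Rightarrow> bool"
  for nxt :: "'s \<Rightarrow> 's"
where
  beta: "rt_step nxt L 0 (App V (Lam W T)) (LDef (Cast W V) T)"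
| delta: "rt_step nxt ((Def, V) # K) 0 (Var 0) (lift 0 V)"
| zeta: "rt_step nxt L 0 (LDef V (lift 0 T)) T"
| theta: "rt_step nxt L 0 (App V (LDef W T)) (LDef W (App (lift 0 V) T))"
| cast_term: "rt_step nxt L 0 (Cast U T) T"
| sort: "rt_step nxt L 1 (Sort s) (Sort (nxt s))"
| decl: "rt_step nxt ((Dec, W) # K) 1 (Var 0) (lift 0 W)"
| cast_type: "rt_step nxt L 1 (Cast U T) U"
| weaken: "rt_step nxt K n (Var i) T \<Longrightarrow>
    rt_step nxt ((b, V) # K) n (Var (Suc i)) (lift 0 T)"
| app_arg: "rt_step nxt L 0 V1 V2 \<Longrightarrow> rt_step nxt L 0 (App V1 T) (App V2 T)"
| app_fun: "rt_step nxt L n T1 T2 \<Longrightarrow> rt_step nxt L n (App V T1) (App V T2)"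
| bind_entry: "rt_step nxt L 0 V1 V2 \<Longrightarrow> rt_step nxt L 0 (Bind b V1 T) (Bind b V2 T)"
| bind_body: "rt_step nxt ((b, V) # L) n T1 T2 \<Longrightarrow>
    rt_step nxt L n (Bind b V T1) (Bind b V T2)"
| cast_left: "rt_step nxt L 0 U1 U2 \<Longrightarrow> rt_step nxt L 0 (Cast U1 T) (Cast U2 T)"
| cast_right: "rt_step nxt L 0 T1 T2 \<Longrightarrow> rt_step nxt L 0 (Cast U T1) (Cast U T2)"
| cast_both: "rt_step nxt L 1 U1 U2 \<Longrightarrow> rt_step nxt L 1 T1 T2 \<Longrightarrow>
    rt_step nxt L 1 (Cast U1 T1) (Cast U2 T2)"

inductive rt_steps ::
  "('s \<Rightarrow> 's) \<Rightarrow> 's env \<Rightarrow> nat \<Rightarrow> 's trm \<Rightarrow> 's trm \<Rightarrow> bool"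
  for nxt :: "'s \<Rightarrow> 's"
where
  refl: "rt_steps nxt L 0 T T"
| step: "rt_step nxt L n T1 T2 \<Longrightarrow> rt_steps nxt L n T1 T2"
| trans: "rt_steps nxt L n1 T1 T \<Longrightarrow> rt_steps nxt L n2 T T2 \<Longrightarrow>
    rt_steps nxt L (n1 + n2) T1 T2"

inductive valid ::
  "('s \<Rightarrow> 's) \<Rightarrow> nat set \<Rightarrow> 's env \<Rightarrow> 's trm \<Rightarrow> bool"
  for nxt :: "'s \<Rightarrow> 's" and A :: "nat set"
where
  sort: "valid nxt A L (Sort s)"
| var_head: "valid nxt A K V \<Longrightarrow> valid nxt A ((b, V) # K) (Var 0)"
| var_tail: "valid nxt A K (Var i) \<Longrightarrow> valid nxt A ((b, V) # K) (Var (Suc i))"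
| bind: "valid nxt A L V \<Longrightarrow> valid nxt A ((b, V) # L) T \<Longrightarrow> valid nxt A L (Bind b V T)"
| cast: "valid nxt A L U \<Longrightarrow> valid nxt A L T \<Longrightarrow>
    rt_steps nxt L 1 T U0 \<Longrightarrow> rt_steps nxt L 0 U U0 \<Longrightarrow> valid nxt A L (Cast U T)"
| app: "valid nxt A L V \<Longrightarrow> valid nxt A L T \<Longrightarrow> n \<in> A \<Longrightarrow>
    rt_steps nxt L n T (Lam W0 U0) \<Longrightarrow> rt_steps nxt L 1 V W0 \<Longrightarrow> valid nxt A L (App V T)"

definition has_type ::
  "('s \<Rightarrow> 's) \<Rightarrow> nat set \<Rightarrow> 's env \<Rightarrow> 's trm \<Rightarrow> 's trm \<Rightarrow> bool"
where
  "has_type nxt A L T U \<longleftrightarrow> valid nxt A L (Cast U T)"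

end

theory Submission
  imports Defs
begin

text \<open>
  The difficulty is that rt-reduction is confluent only on valid terms, while validity is
  preserved by reduction only thanks to confluence.  We break this circle without strong
  normalization.  A term in an environment is interpreted as a plain \<open>\<lambda>\<close>-term with casts
  erased and definitions unfolded, on which the type step is a total function \<open>ty\<close>.
  Conversion \<open>conv\<close> is generated by the \<^emph>\<open>safe\<close> \<open>\<beta>\<close>-steps only, those contracting
  \<open>(\<lambda>x:w. t) v\<close> where \<open>ty v\<close> is itself convertible to \<open>w\<close>.  Safety makes conversion stable
  under substitution and under \<open>ty\<close>, for all terms, and then parallel safe reduction is
  confluent for all terms, so that abstractions convert only if their domains do.

  Validity is restated as \<open>cvalid\<close>, with its side conditions expressed by \<open>ty\<close> and \<open>conv\<close>.  In a
  \<open>cvalid\<close> term every \<open>\<beta>\<close>-redex is safe and every cast is harmless, so \<open>cvalid\<close> is preserved by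
  rt-reduction, which yields that it is equivalent to validity.  For \<open>cvalid\<close> a type is built
  by recursion on the term: \<open>App V T\<close> gets the type \<open>App V U\<close> where \<open>U\<close> is a type of \<open>T\<close>, because
  the type of an abstraction is an abstraction with the same domain.
\<close>

subsection \<open>Lambda terms and safe conversion\<close>

datatype 's lam =
    LSort 's
  | LVar nat
  | LApp "'s lam" "'s lam"
  | LLam "'s lam" "'s lam"

primrec upr :: "(nat \<Rightarrow> nat) \<Rightarrow> nat \<Rightarrow> nat" where
  "upr r 0 = 0"
| "upr r (Suc i) = Suc (r i)"

primrec ren :: "(nat \<Rightarrow> nat) \<Rightarrow> 's lam \<Rightarrow> 's lam" where
  "ren r (LSort s) = LSort s"
| "ren r (LVar i) = LVar (r i)"
| "ren r (LApp v t) = LApp (ren r v) (ren r t)"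
| "ren r (LLam w t) = LLam (ren r w) (ren (upr r) t)"

primrec scons :: "'a \<Rightarrow> (nat \<Rightarrow> 'a) \<Rightarrow> nat \<Rightarrow> 'a" where
  "scons a \<sigma> 0 = a"
| "scons a \<sigma> (Suc i) = \<sigma> i"

definition up :: "(nat \<Rightarrow> 's lam) \<Rightarrow> nat \<Rightarrow> 's lam" where
  "up \<sigma> = scons (LVar 0) (\<lambda>i. ren Suc (\<sigma> i))"

primrec subst :: "(nat \<Rightarrow> 's lam) \<Rightarrow> 's lam \<Rightarrow> 's lam" where
  "subst \<sigma> (LSort s) = LSort s"
| "subst \<sigma> (LVar i) = \<sigma> i"
| "subst \<sigma> (LApp v t) = LApp (subst \<sigma> v) (subst \<sigma> t)"
| "subst \<sigma> (LLam w t) = LLam (subst \<sigma> w) (subst (up \<sigma>) t)"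

abbreviation inst :: "'s lam \<Rightarrow> 's lam \<Rightarrow> 's lam" where
  "inst v \<equiv> subst (scons v LVar)"


section \<open>Renaming and substitution on lambda terms\<close>

lemma fun_nat_eqI: "f 0 = g 0 \<Longrightarrow> (\<And>i. f (Suc i) = g (Suc i)) \<Longrightarrow> f = g"
  for f g :: "nat \<Rightarrow> 'a"
  by (rule ext) (metis not0_implies_Suc)

lemma up_simps [simp]: "up \<sigma> 0 = LVar 0" "up \<sigma> (Suc i) = ren Suc (\<sigma> i)"
  by (simp_all add: up_def)

lemma upr_comp: "upr r (upr r' i) = upr (\<lambda>i. r (r' i)) i"
  by (cases i) simp_all

lemma ren_ren: "ren r (ren r' t) = ren (\<lambda>i. r (r' i)) t"
  by (induction t arbitrary: r r') (simp_all add: upr_comp)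

lemma subst_ren: "subst \<sigma> (ren r t) = subst (\<lambda>i. \<sigma> (r i)) t"
proof (induction t arbitrary: \<sigma> r)
  case (LLam w t)
  have "(\<lambda>i. up \<sigma> (upr r i)) = up (\<lambda>i. \<sigma> (r i))"
    by (rule fun_nat_eqI) simp_all
  then show ?case by (simp add: LLam)
qed simp_all

lemma ren_subst: "ren r (subst \<sigma> t) = subst (\<lambda>i. ren r (\<sigma> i)) t"
proof (induction t arbitrary: \<sigma> r)
  case (LLam w t)
  have "(\<lambda>i. ren (upr r) (up \<sigma> i)) = up (\<lambda>i. ren r (\<sigma> i))"
    by (rule fun_nat_eqI) (simp_all add: ren_ren)
  then show ?case by (simp add: LLam)
qed simp_all

lemma subst_up_lift: "subst (up \<sigma>) (ren Suc t) = ren Suc (subst \<sigma> t)"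
  by (simp add: subst_ren ren_subst)

lemma subst_subst: "subst \<tau> (subst \<sigma> t) = subst (\<lambda>i. subst \<tau> (\<sigma> i)) t"
proof (induction t arbitrary: \<sigma> \<tau>)
  case (LLam w t)
  have "(\<lambda>i. subst (up \<tau>) (up \<sigma> i)) = up (\<lambda>i. subst \<tau> (\<sigma> i))"
    by (rule fun_nat_eqI) (simp_all add: subst_up_lift)
  then show ?case by (simp add: LLam)
qed simp_all

lemma up_LVar [simp]: "up LVar = LVar"
  by (rule fun_nat_eqI) simp_all

lemma subst_LVar [simp]: "subst LVar t = t"
  by (induction t) simp_all

lemma subst_scons_lift [simp]: "subst (scons v \<sigma>) (ren Suc t) = subst \<sigma> t"
  by (simp add: subst_ren)

lemma subst_inst: "subst \<sigma> (inst v t) = inst (subst \<sigma> v) (subst (up \<sigma>) t)"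
proof -
  have "(\<lambda>i. subst \<sigma> (scons v LVar i)) = (\<lambda>i. inst (subst \<sigma> v) (up \<sigma> i))"
    by (rule fun_nat_eqI) simp_all
  then show ?thesis by (simp add: subst_subst)
qed

lemma ren_as_subst: "ren r t = subst (\<lambda>i. LVar (r i)) t"
  using subst_ren[of LVar r t] by simp

lemma ren_inst: "ren r (inst v t) = inst (ren r v) (ren (upr r) t)"
proof -
  have "(\<lambda>i. ren r (scons v LVar i)) = (\<lambda>i. scons (ren r v) LVar (upr r i))"
    by (rule fun_nat_eqI) simp_all
  then show ?thesis by (simp add: ren_subst subst_ren)
qed

lemma ren_upr_lift: "ren (upr r) (ren Suc t) = ren Suc (ren r t)"
  by (simp add: ren_ren)

text \<open>An undeclared variable is its own type, so that \<open>ty\<close> commutes with weakening and substitution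
  without side conditions.\<close>

primrec look :: "'s lam list \<Rightarrow> nat \<Rightarrow> 's lam" where
  "look [] = LVar"
| "look (w # G) = scons (ren Suc w) (\<lambda>i. ren Suc (look G i))"

primrec ty :: "('s \<Rightarrow> 's) \<Rightarrow> 's lam list \<Rightarrow> 's lam \<Rightarrow> 's lam" where
  "ty nxt G (LSort s) = LSort (nxt s)"
| "ty nxt G (LVar i) = look G i"
| "ty nxt G (LApp v t) = LApp v (ty nxt G t)"
| "ty nxt G (LLam w t) = LLam w (ty nxt (w # G) t)"

text \<open>Safety of a redex is itself a conversion, so both notions arise in one inductive
  definition. Totality of \<open>ty\<close> lets the guard make sense for ill-formed terms
  too.\<close>

inductive conv :: "('s \<Rightarrow> 's) \<Rightarrow> 's lam list \<Rightarrow> 's lam \<Rightarrow> 's lam \<Rightarrow> bool"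
  for nxt :: "'s \<Rightarrow> 's"
where
  conv_refl: "conv nxt G t t"
| conv_sym: "conv nxt G t t' \<Longrightarrow> conv nxt G t' t"
| conv_trans [trans]: "conv nxt G t t' \<Longrightarrow> conv nxt G t' t'' \<Longrightarrow> conv nxt G t t''"
| conv_app: "conv nxt G v v' \<Longrightarrow> conv nxt G t t' \<Longrightarrow> conv nxt G (LApp v t) (LApp v' t')"
| conv_lam: "conv nxt G w w' \<Longrightarrow> conv nxt (w # G) t t' \<Longrightarrow>
    conv nxt G (LLam w t) (LLam w' t')"
| conv_beta: "conv nxt G (ty nxt G v) w \<Longrightarrow> conv nxt G (LApp v (LLam w t)) (inst v t)"

section \<open>Stability of \<open>ty\<close> and \<open>conv\<close> under renaming and
  substitution\<close>

lemma ty_ren: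
  assumes "\<And>i. look D (r i) = ren r (look G i)"
  shows "ty nxt D (ren r t) = ren r (ty nxt G t)"
  using assms
proof (induction t arbitrary: D G r)
  case (LLam w t)
  have "look (ren r w # D) (upr r i) = ren (upr r) (look (w # G) i)" for i
    by (cases i) (simp_all add: LLam.prems ren_upr_lift ren_ren)
  from LLam.IH(2)[OF this] show ?case by simp
qed simp_all

lemma conv_ren:
  assumes "conv nxt G t t'" and "\<And>i. look D (r i) = ren r (look G i)"
  shows "conv nxt D (ren r t) (ren r t')"
  using assms
proof (induction arbitrary: D r rule: conv.induct)
  case (conv_lam G w w' t t')
  have "look (ren r w # D) (upr r i) = ren (upr r) (look (w # G) i)" for i
    by (cases i) (simp_all add: conv_lam.prems ren_ren)
  with conv_lam show ?case by (auto intro: conv.conv_lam)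
next
  case (conv_beta G v w t)
  then show ?case
    using conv.conv_beta[of nxt D "ren r v" "ren r w" "ren (upr r) t"]
    by (simp add: ren_inst ty_ren)
qed (simp_all, (meson conv.intros)+)

lemma conv_lift: "conv nxt G t t' \<Longrightarrow> conv nxt (w # G) (ren Suc t) (ren Suc t')"
  by (rule conv_ren) simp_all

lemma ty_lift: "ty nxt (w # G) (ren Suc t) = ren Suc (ty nxt G t)"
  by (rule ty_ren) simp

text \<open>Unlike for a well-typed substitution, only variables are constrained, and no validity is assumed.\<close>

definition morph ::
  "('s \<Rightarrow> 's) \<Rightarrow> 's lam list \<Rightarrow> 's lam list \<Rightarrow> (nat \<Rightarrow> 's lam) \<Rightarrow> bool"
where
  "morph nxt G D \<delta> \<longleftrightarrow> (\<forall>i. conv nxt D (ty nxt D (\<delta> i)) (subst \<delta> (look G i)))"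

text \<open>The new head may merely convert to \<open>subst \<delta> w\<close>. This makes the
  identity a morphism between contexts with convertible heads, and serves \<open>smorph_up\<close>,
  where heads are known only up to conversion.\<close>

lemma morph_up:
  assumes "morph nxt G D \<delta>" and "conv nxt D w' (subst \<delta> w)"
  shows "morph nxt (w # G) (w' # D) (up \<delta>)"
  unfolding morph_def
proof
  fix i
  show "conv nxt (w' # D) (ty nxt (w' # D) (up \<delta> i)) (subst (up \<delta>) (look (w # G) i))"
    using assms by (cases i) (auto simp: morph_def subst_up_lift ty_lift intro: conv_lift)
qed

lemma morph_up_same: "morph nxt G D \<delta> \<Longrightarrow> morph nxt (w # G) (subst \<delta> w # D) (up \<delta>)"
  by (simp add: morph_up conv_refl)

lemma ty_subst:
  assumes "morph nxt G D \<delta>"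
  shows "conv nxt D (ty nxt D (subst \<delta> t)) (subst \<delta> (ty nxt G t))"
  using assms
proof (induction t arbitrary: G D \<delta>)
  case (LVar i)
  then show ?case by (simp add: morph_def)
next
  case (LLam w t)
  then show ?case by (simp add: conv_lam conv_refl morph_up_same)
qed (simp_all add: conv_refl conv_app)

text \<open>A safe redex stays safe: the induction hypothesis transports its guard, and
  \<open>ty_subst\<close> moves the type across the substitution.\<close>

lemma conv_subst:
  assumes "conv nxt G t t'" and "morph nxt G D \<delta>"
  shows "conv nxt D (subst \<delta> t) (subst \<delta> t')"
  using assms
proof (induction arbitrary: D \<delta> rule: conv.induct)
  case (conv_lam G w w' t t')
  then show ?case by (simp add: conv.conv_lam morph_up_same)
next
  case (conv_beta G v w t)
  then have "conv nxt D (ty nxt D (subst \<delta> v)) (subst \<delta> w)"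
    by (meson ty_subst conv_trans)
  then show ?case
    using conv.conv_beta[of nxt D "subst \<delta> v" "subst \<delta> w" "subst (up \<delta>) t"]
    by (simp add: subst_inst)
qed (simp_all, (meson conv.intros)+)

lemma morph_conv_hd: "conv nxt G w w' \<Longrightarrow> morph nxt (w # G) (w' # G) LVar"
  using morph_up[of nxt G G LVar w' w]
  by (auto simp: morph_def intro: conv.intros)

lemma morph_inst: "conv nxt G (ty nxt G v) w \<Longrightarrow> morph nxt (w # G) G (scons v LVar)"
  unfolding morph_def
proof
  fix i
  assume "conv nxt G (ty nxt G v) w"
  then show "conv nxt G (ty nxt G (scons v LVar i)) (inst v (look (w # G) i))"
    by (cases i) (auto intro: conv_refl)
qed

text \<open>An abstraction keeps its domain under \<open>ty\<close>, so the type of a safe redex is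
  a redex with the same guard; \<open>ty_subst\<close> identifies its contractum with the type of
  the original contractum.\<close>

lemma conv_ty: "conv nxt G t t' \<Longrightarrow> conv nxt G (ty nxt G t) (ty nxt G t')"
proof (induction rule: conv.induct)
  case (conv_lam G w w' t t')
  \<comment> \<open>\<open>ty\<close> treats the two bodies under different domains; the identity
    morphism carries \<open>t'\<close> from one to the other.\<close>
  have "conv nxt (w # G) (ty nxt (w # G) t') (ty nxt (w' # G) t')"
    using ty_subst[OF morph_conv_hd[OF conv_sym[OF conv_lam.hyps(1)]], of t'] by simp
  with conv_lam show ?case by (auto intro: conv.conv_lam conv_trans)
next
  case (conv_beta G v w t)
  have "conv nxt G (ty nxt G (inst v t)) (inst v (ty nxt (w # G) t))"
    by (rule ty_subst) (rule morph_inst[OF conv_beta.hyps])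
  with conv_beta.hyps show ?case
    by (simp, meson conv.conv_beta conv_sym conv_trans)
qed (simp_all, (meson conv.intros)+)

lemma conv_ty_pow:
  "conv nxt G t t' \<Longrightarrow> conv nxt G ((ty nxt G ^^ n) t) ((ty nxt G ^^ n) t')"
  by (induction n) (auto intro: conv_ty)

subsection \<open>Confluence of safe reduction\<close>

text \<open>The guard is full conversion, already stable under substitution and \<open>ty\<close>,
  so the definition presupposes no confluence.\<close>

inductive par :: "('s \<Rightarrow> 's) \<Rightarrow> 's lam list \<Rightarrow> 's lam \<Rightarrow> 's lam \<Rightarrow> bool"
  for nxt :: "'s \<Rightarrow> 's"
where
  par_sort: "par nxt G (LSort s) (LSort s)"
| par_var: "par nxt G (LVar i) (LVar i)"
| par_app: "par nxt G v v' \<Longrightarrow> par nxt G t t' \<Longrightarrow> par nxt G (LApp v t) (LApp v' t')"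
| par_lam: "par nxt G w w' \<Longrightarrow> par nxt (w # G) t t' \<Longrightarrow> par nxt G (LLam w t) (LLam w' t')"
| par_beta: "conv nxt G (ty nxt G v) w \<Longrightarrow> par nxt G v v' \<Longrightarrow> par nxt (w # G) t t' \<Longrightarrow>
    par nxt G (LApp v (LLam w t)) (inst v' t')"

inductive_cases par_sortE: "par nxt G (LSort s) u"
inductive_cases par_varE: "par nxt G (LVar i) u"
inductive_cases par_appE: "par nxt G (LApp v t) u"
inductive_cases par_lamE: "par nxt G (LLam w t) u"

lemma par_refl: "par nxt G t t"
  by (induction t arbitrary: G) (auto intro: par.intros)

lemma par_ren:
  assumes "par nxt G t t'" and "\<And>i. look D (r i) = ren r (look G i)"
  shows "par nxt D (ren r t) (ren r t')"
  using assms
proof (induction arbitrary: D r rule: par.induct)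
  case (par_lam G w w' t t')
  have "look (ren r w # D) (upr r i) = ren (upr r) (look (w # G) i)" for i
    by (cases i) (simp_all add: par_lam.prems ren_ren)
  with par_lam show ?case by (auto intro: par.par_lam)
next
  case (par_beta G v w v' t t')
  have "look (ren r w # D) (upr r i) = ren (upr r) (look (w # G) i)" for i
    by (cases i) (simp_all add: par_beta.prems ren_ren)
  moreover have "conv nxt D (ty nxt D (ren r v)) (ren r w)"
    using conv_ren[OF par_beta.hyps(1) par_beta.prems] by (simp add: ty_ren par_beta.prems)
  ultimately show ?case
    using par_beta by (auto simp: ren_inst intro: par.par_beta)
qed (auto intro: par.intros)

lemma par_subst:
  assumes "par nxt G t t'" and "morph nxt G D \<delta>" and "\<And>i. par nxt D (\<delta> i) (\<delta>' i)"
  shows "par nxt D (subst \<delta> t) (subst \<delta>' t')"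
  using assms
proof (induction arbitrary: D \<delta> \<delta>' rule: par.induct)
  case (par_lam G w w' t t')
  have "par nxt (subst \<delta> w # D) (up \<delta> i) (up \<delta>' i)" for i
    by (cases i) (auto intro: par.intros par_ren par_lam.prems)
  with par_lam show ?case by (simp add: par.par_lam morph_up_same)
next
  case (par_beta G v w v' t t')
  have 1: "par nxt (subst \<delta> w # D) (up \<delta> i) (up \<delta>' i)" for i
    by (cases i) (auto intro: par.intros par_ren par_beta.prems)
  have "conv nxt D (ty nxt D (subst \<delta> v)) (subst \<delta> w)"
    using par_beta by (meson ty_subst conv_trans conv_subst)
  then have "par nxt D (LApp (subst \<delta> v) (LLam (subst \<delta> w) (subst (up \<delta>) t)))
      (inst (subst \<delta>' v') (subst (up \<delta>') t'))"
    using par_beta 1 by (intro par.par_beta) (simp_all add: morph_up_same)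
  then show ?case by (simp add: subst_inst)
qed (auto intro: par.intros)

text \<open>Reducing inside the redex first leaves it safe, since \<open>conv_ty\<close> keeps the
  type of \<open>v'\<close> convertible to that of \<open>v\<close>.\<close>

lemma par_conv: "par nxt G t t' \<Longrightarrow> conv nxt G t t'"
proof (induction rule: par.induct)
  case (par_beta G v w v' t t')
  have "conv nxt G (LApp v (LLam w t)) (LApp v' (LLam w t'))"
    using par_beta by (auto intro: conv.intros)
  moreover have "conv nxt G (LApp v' (LLam w t')) (inst v' t')"
    using par_beta by (meson conv.conv_beta conv_sym conv_trans conv_ty)
  ultimately show ?case by (rule conv_trans)
qed (auto intro: conv.intros)

lemma par_hd: "par nxt (w # G) t t' \<Longrightarrow> conv nxt G w w' \<Longrightarrow> par nxt (w' # G) t t'"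
  using par_subst[OF _ morph_conv_hd, of nxt w G t t' w' LVar] by (auto intro: par_var)

text \<open>Takahashi's complete development; one-step reducts all reduce to it, hence the diamond property.\<close>

fun dev :: "('s \<Rightarrow> 's) \<Rightarrow> 's lam list \<Rightarrow> 's lam \<Rightarrow> 's lam" where
  "dev nxt G (LSort s) = LSort s"
| "dev nxt G (LVar i) = LVar i"
| "dev nxt G (LLam w t) = LLam (dev nxt G w) (dev nxt (w # G) t)"
| "dev nxt G (LApp v (LLam w t)) =
    (if conv nxt G (ty nxt G v) w then inst (dev nxt G v) (dev nxt (w # G) t)
     else LApp (dev nxt G v) (LLam (dev nxt G w) (dev nxt (w # G) t)))"
| "dev nxt G (LApp v t) = LApp (dev nxt G v) (dev nxt G t)"

lemma par_inst:
  assumes "conv nxt G (ty nxt G v) w" and "par nxt G v v'" and "par nxt (w # G) t t'"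
  shows "par nxt G (inst v t) (inst v' t')"
  using assms(3) morph_inst[OF assms(1)]
proof (rule par_subst)
  fix i show "par nxt G (scons v LVar i) (scons v' LVar i)"
    using assms(2) by (cases i) (auto intro: par_var)
qed

lemma par_dev: "par nxt G t t' \<Longrightarrow> par nxt G t' (dev nxt G t)"
proof (induction nxt G t arbitrary: t' rule: dev.induct)
  case (3 nxt G w t)
  from 3(3) obtain w' s where t': "t' = LLam w' s" "par nxt G w w'" "par nxt (w # G) t s"
    by (auto elim: par_lamE)
  \<comment> \<open>The induction hypothesis speaks about the context with \<open>w\<close>, but
    \<open>s\<close> now stands under the reduced domain \<open>w'\<close>.\<close>
  have "par nxt (w' # G) s (dev nxt (w # G) t)"
    using 3(2)[OF t'(3)] par_conv[OF t'(2)] by (rule par_hd)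
  with 3(1)[OF t'(2)] t'(1) show ?case by (auto intro: par_lam)
next
  case (4 nxt G v w t)
  note IH = 4
  from 4 consider
      (app) v' w' s where "t' = LApp v' (LLam w' s)" "par nxt G v v'" "par nxt G w w'"
        "par nxt (w # G) t s"
    | (beta) v' s where "t' = inst v' s" "conv nxt G (ty nxt G v) w" "par nxt G v v'"
        "par nxt (w # G) t s"
    by (auto elim!: par_appE par_lamE)
  then show ?case
  proof cases
    case app
    note ww' = par_conv[OF app(3)]
    show ?thesis
    proof (cases "conv nxt G (ty nxt G v) w")
      case True
      \<comment> \<open>The redex survives in \<open>t'\<close> with both argument and domain
        reduced, and is still safe there.\<close>
      have "conv nxt G (ty nxt G v') w'"
        using True ww' par_conv[OF app(2)] by (meson conv_ty conv_sym conv_trans)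
      with True app ww' IH show ?thesis by (auto intro!: par_beta intro: par_hd)
    next
      case False
      with app ww' IH show ?thesis by (auto intro!: par_app par_lam intro: par_hd)
    qed
  next
    case beta
    have "conv nxt G (ty nxt G v') w"
      using beta(2) par_conv[OF beta(3)] by (meson conv_ty conv_sym conv_trans)
    with beta IH show ?thesis by (auto intro!: par_inst)
  qed
qed (auto elim!: par_sortE par_varE par_appE intro: par.intros)

abbreviation pars :: "('s \<Rightarrow> 's) \<Rightarrow> 's lam list \<Rightarrow> 's lam \<Rightarrow> 's lam \<Rightarrow> bool" where
  "pars nxt G \<equiv> (par nxt G)\<^sup>*\<^sup>*"

lemma pars_strip:
  "pars nxt G t t1 \<Longrightarrow> par nxt G t t2 \<Longrightarrow> \<exists>u. par nxt G t1 u \<and> pars nxt G t2 u"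
proof (induction arbitrary: t2 rule: converse_rtranclp_induct)
  case base
  then show ?case by blast
next
  case (step t t')
  from step.IH[OF par_dev[OF step(1)]] obtain u where
    "par nxt G t1 u" "pars nxt G (dev nxt G t) u" by blast
  with par_dev[OF step.prems] show ?case by (meson converse_rtranclp_into_rtranclp)
qed

lemma pars_confluent:
  "pars nxt G t t1 \<Longrightarrow> pars nxt G t t2 \<Longrightarrow> \<exists>u. pars nxt G t1 u \<and> pars nxt G t2 u"
proof (induction arbitrary: t2 rule: converse_rtranclp_induct)
  case base
  then show ?case by blast
next
  case (step t t')
  obtain u where "par nxt G t2 u" "pars nxt G t' u"
    using pars_strip[OF step.prems step(1)] by blast
  with step.IH[of u] show ?case by (meson converse_rtranclp_into_rtranclp)
qed

lemma pars_app: "pars nxt G v v' \<Longrightarrow> pars nxt G t t' \<Longrightarrow> pars nxt G (LApp v t) (LApp v' t')"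
proof -
  assume "pars nxt G t t'"
  then have 1: "pars nxt G (LApp v t) (LApp v t')"
    by (induction rule: rtranclp_induct) (blast, meson rtranclp.rtrancl_into_rtrancl par_app par_refl)
  assume "pars nxt G v v'"
  then have "pars nxt G (LApp v t') (LApp v' t')"
    by (induction rule: rtranclp_induct) (blast, meson rtranclp.rtrancl_into_rtrancl par_app par_refl)
  with 1 show ?thesis by simp
qed

lemma pars_lam:
  assumes "pars nxt G w w'" and "pars nxt (w # G) t t'"
  shows "pars nxt G (LLam w t) (LLam w' t')"
proof -
  \<comment> \<open>Body first: its steps are given under the unreduced domain
    \<open>w\<close>.\<close>
  from assms(2) have 1: "pars nxt G (LLam w t) (LLam w t')"
    by (induction rule: rtranclp_induct) (blast, meson rtranclp.rtrancl_into_rtrancl par_lam par_refl)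
  from assms(1) have "pars nxt G (LLam w t') (LLam w' t')"
    by (induction rule: rtranclp_induct) (blast, meson rtranclp.rtrancl_into_rtrancl par_lam par_refl)
  with 1 show ?thesis by simp
qed

lemma pars_conv: "pars nxt G t t' \<Longrightarrow> conv nxt G t t'"
  by (induction rule: rtranclp_induct) (meson conv_refl conv_trans par_conv)+

lemma pars_hd: "pars nxt (w # G) t t' \<Longrightarrow> conv nxt G w w' \<Longrightarrow> pars nxt (w' # G) t t'"
  by (induction rule: rtranclp_induct) (meson rtranclp.rtrancl_refl rtranclp.rtrancl_into_rtrancl par_hd)+

text \<open>Church-Rosser for safe conversion: \<open>conv_beta\<close> has the guard of
  \<open>par_beta\<close>, and transitivity is handled by confluence.\<close>

lemma conv_joinable: "conv nxt G t t' \<Longrightarrow> \<exists>u. pars nxt G t u \<and> pars nxt G t' u"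
proof (induction rule: conv.induct)
  case (conv_refl G t)
  show ?case by blast
next
  case (conv_sym G t t')
  from conv_sym.IH show ?case by blast
next
  case (conv_trans G t t' t'')
  then obtain u u' where "pars nxt G t u" "pars nxt G t' u" "pars nxt G t' u'"
    "pars nxt G t'' u'" by blast
  moreover from pars_confluent[OF this(2,3)] obtain u0
    where "pars nxt G u u0" "pars nxt G u' u0" by blast
  ultimately have "pars nxt G t u0" "pars nxt G t'' u0" by simp_all
  then show ?case by blast
next
  case (conv_app G v v' t t')
  from conv_app.IH obtain v0 t0 where "pars nxt G v v0" "pars nxt G v' v0"
    "pars nxt G t t0" "pars nxt G t' t0" by blast
  then have "pars nxt G (LApp v t) (LApp v0 t0)" "pars nxt G (LApp v' t') (LApp v0 t0)"
    by (simp_all add: pars_app)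
  then show ?case by blast
next
  case (conv_lam G w w' t t')
  from conv_lam.IH obtain w0 t0 where "pars nxt G w w0" "pars nxt G w' w0"
    "pars nxt (w # G) t t0" "pars nxt (w # G) t' t0" by blast
  moreover from pars_hd[OF this(4) conv_lam.hyps(1)] have "pars nxt (w' # G) t' t0" .
  ultimately have "pars nxt G (LLam w t) (LLam w0 t0)" "pars nxt G (LLam w' t') (LLam w0 t0)"
    by (simp_all add: pars_lam)
  then show ?case by blast
next
  case (conv_beta G v w t)
  from conv_beta.hyps have "par nxt G (LApp v (LLam w t)) (inst v t)"
    by (intro par_beta par_refl)
  then show ?case by blast
qed

lemma pars_lamD:
  "pars nxt G (LLam w t) u \<Longrightarrow> \<exists>w' t'. u = LLam w' t' \<and> pars nxt G w w'"
proof (induction rule: rtranclp_induct)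
  case (step u u')
  then obtain w' t' where "u = LLam w' t'" "pars nxt G w w'" by blast
  with step(2) show ?case by (metis par_lamE rtranclp.rtrancl_into_rtrancl)
qed blast

text \<open>The consequence of confluence on which preservation under rule \<open>beta\<close>
  rests.\<close>

lemma conv_lamD:
  assumes "conv nxt G (LLam w t) (LLam w' t')"
  shows "conv nxt G w w'"
proof -
  from conv_joinable[OF assms] obtain u
    where "pars nxt G (LLam w t) u" "pars nxt G (LLam w' t') u" by blast
  then obtain w0 where "pars nxt G w w0" "pars nxt G w' w0" by (blast dest: pars_lamD)
  then show ?thesis by (meson pars_conv conv_sym conv_trans)
qed

subsection \<open>Interpretation of terms in environments\<close>

text \<open>Carrying the values \<open>\<sigma>\<close> of the free indices turns the unfolding of a
  definition into an extension of \<open>\<sigma>\<close>.\<close>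

primrec interp :: "'s trm \<Rightarrow> (nat \<Rightarrow> 's lam) \<Rightarrow> 's lam" where
  "interp (Sort s) \<sigma> = LSort s"
| "interp (Var i) \<sigma> = \<sigma> i"
| "interp (App V T) \<sigma> = LApp (interp V \<sigma>) (interp T \<sigma>)"
| "interp (Bind b V T) \<sigma> =
    (case b of Dec \<Rightarrow> LLam (interp V \<sigma>) (interp T (up \<sigma>)) | Def \<Rightarrow> interp T (scons (interp V \<sigma>) \<sigma>))"
| "interp (Cast U T) \<sigma> = interp T \<sigma>"

lemma interp_subst: "subst \<tau> (interp T \<sigma>) = interp T (\<lambda>i. subst \<tau> (\<sigma> i))"
proof (induction T arbitrary: \<sigma> \<tau>)
  case (Bind b V T)
  have "(\<lambda>i. subst (up \<tau>) (up \<sigma> i)) = up (\<lambda>i. subst \<tau> (\<sigma> i))"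
    by (rule fun_nat_eqI) (simp_all add: subst_up_lift)
  moreover have "(\<lambda>i. subst \<tau> (scons v \<sigma> i)) = scons (subst \<tau> v) (\<lambda>i. subst \<tau> (\<sigma> i))" for v
    by (rule fun_nat_eqI) simp_all
  ultimately show ?case by (cases b) (simp_all add: Bind)
qed simp_all

lemma interp_ren: "ren r (interp T \<sigma>) = interp T (\<lambda>i. ren r (\<sigma> i))"
  by (simp add: ren_as_subst interp_subst)

lemma interp_lift: "interp (lift c T) \<sigma> = interp T (\<lambda>i. \<sigma> (if i < c then i else Suc i))"
proof (induction T arbitrary: c \<sigma>)
  case (Bind b V T)
  have "(\<lambda>i. up \<sigma> (if i < Suc c then i else Suc i)) = up (\<lambda>i. \<sigma> (if i < c then i else Suc i))"
    by (rule fun_nat_eqI) simp_all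
  moreover have "(\<lambda>i. scons v \<sigma> (if i < Suc c then i else Suc i))
      = scons v (\<lambda>i. \<sigma> (if i < c then i else Suc i))" for v
    by (rule fun_nat_eqI) simp_all
  ultimately show ?case by (cases b) (simp_all add: Bind)
qed simp_all

lemma interp_lift_scons [simp]: "interp (lift 0 T) (scons v \<sigma>) = interp T \<sigma>"
  by (simp add: interp_lift)

lemma interp_lift_up [simp]: "interp (lift 0 T) (up \<sigma>) = ren Suc (interp T \<sigma>)"
  by (simp add: interp_lift interp_ren)

lemma interp_conv:
  "(\<And>i. conv nxt G (\<sigma> i) (\<tau> i)) \<Longrightarrow> conv nxt G (interp T \<sigma>) (interp T \<tau>)"
proof (induction T arbitrary: G \<sigma> \<tau>)
  case (Bind b V T)
  have 1: "conv nxt (interp V \<sigma> # G) (up \<sigma> i) (up \<tau> i)" for i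
    using Bind.prems by (cases i) (auto intro: conv_refl conv_lift)
  have 2: "conv nxt G (scons (interp V \<sigma>) \<sigma> i) (scons (interp V \<tau>) \<tau> i)" for i
    using Bind by (cases i) auto
  show ?case
    by (cases b) (auto intro: conv_lam Bind.IH(1)[OF Bind.prems] Bind.IH(2)[OF 1] Bind.IH(2)[OF 2])
qed (auto intro: conv_refl conv_app)

text \<open>A definition occupies an index in \<open>L\<close> but none in \<open>ctx L\<close>;
  \<open>env_subst\<close> bridges this by sending a defined variable to the value of its
  definiens.\<close>

fun env_subst :: "'s env \<Rightarrow> nat \<Rightarrow> 's lam" where
  "env_subst [] = LVar"
| "env_subst ((Dec, W) # K) = up (env_subst K)"
| "env_subst ((Def, V) # K) = scons (interp V (env_subst K)) (env_subst K)"

fun ctx :: "'s env \<Rightarrow> 's lam list" where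
  "ctx [] = []"
| "ctx ((Dec, W) # K) = interp W (env_subst K) # ctx K"
| "ctx ((Def, V) # K) = ctx K"

abbreviation sem :: "'s env \<Rightarrow> 's trm \<Rightarrow> 's lam" where
  "sem L T \<equiv> interp T (env_subst L)"

subsection \<open>Validity up to conversion\<close>

text \<open>The witnesses \<open>w\<close> and \<open>u\<close> of \<open>cv_app\<close> are
  arbitrary lambda terms; actual reducts are recovered from them only in
  \<open>cvalid_imp_valid\<close>.\<close>

inductive cvalid :: "('s \<Rightarrow> 's) \<Rightarrow> nat set \<Rightarrow> 's env \<Rightarrow> 's trm \<Rightarrow> bool"
  for nxt :: "'s \<Rightarrow> 's" and A :: "nat set"
where
  cv_sort: "cvalid nxt A L (Sort s)"
| cv_head: "cvalid nxt A K V \<Longrightarrow> cvalid nxt A ((b, V) # K) (Var 0)"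
| cv_tail: "cvalid nxt A K (Var i) \<Longrightarrow> cvalid nxt A ((b, V) # K) (Var (Suc i))"
| cv_bind: "cvalid nxt A L V \<Longrightarrow> cvalid nxt A ((b, V) # L) T \<Longrightarrow> cvalid nxt A L (Bind b V T)"
| cv_cast: "cvalid nxt A L U \<Longrightarrow> cvalid nxt A L T \<Longrightarrow>
    conv nxt (ctx L) (ty nxt (ctx L) (sem L T)) (sem L U) \<Longrightarrow> cvalid nxt A L (Cast U T)"
| cv_app: "cvalid nxt A L V \<Longrightarrow> cvalid nxt A L T \<Longrightarrow> n \<in> A \<Longrightarrow>
    conv nxt (ctx L) ((ty nxt (ctx L) ^^ n) (sem L T)) (LLam w u) \<Longrightarrow>
    conv nxt (ctx L) (ty nxt (ctx L) (sem L V)) w \<Longrightarrow> cvalid nxt A L (App V T)"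

inductive_cases cv_headE: "cvalid nxt A L (Var 0)"
inductive_cases cv_tailE: "cvalid nxt A (e # L) (Var (Suc i))"
inductive_cases cv_bindE: "cvalid nxt A L (Bind b V T)"
inductive_cases cv_castE: "cvalid nxt A L (Cast U T)"
inductive_cases cv_appE: "cvalid nxt A L (App V T)"

section \<open>Substitution on terms and stability of \<open>cvalid\<close>\<close>

primrec tup :: "(nat \<Rightarrow> 's trm) \<Rightarrow> nat \<Rightarrow> 's trm" where
  "tup f 0 = Var 0"
| "tup f (Suc i) = lift 0 (f i)"

primrec tsubst :: "(nat \<Rightarrow> 's trm) \<Rightarrow> 's trm \<Rightarrow> 's trm" where
  "tsubst f (Sort s) = Sort s"
| "tsubst f (Var i) = f i"
| "tsubst f (App V T) = App (tsubst f V) (tsubst f T)"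
| "tsubst f (Bind b V T) = Bind b (tsubst f V) (tsubst (tup f) T)"
| "tsubst f (Cast U T) = Cast (tsubst f U) (tsubst f T)"

lemma tup_Var [simp]: "tup Var = Var"
  by (rule fun_nat_eqI) simp_all

lemma tsubst_Var [simp]: "tsubst Var T = T"
  by (induction T) simp_all

lemma lift_as_tsubst: "lift c (T :: 's trm) = tsubst (\<lambda>i. Var (if i < c then i else Suc i)) T"
proof (induction T arbitrary: c)
  case (Bind b V T)
  have "tup (\<lambda>i. Var (if i < c then i else Suc i) :: 's trm) =
      (\<lambda>i. Var (if i < Suc c then i else Suc i))"
    by (rule fun_nat_eqI) simp_all
  with Bind show ?case by simp
qed simp_all

lemma tsubst_lift: "tsubst f (lift c T) = tsubst (\<lambda>i. f (if i < c then i else Suc i)) T"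
proof (induction T arbitrary: c f)
  case (Bind b V T)
  have "(\<lambda>i. tup f (if i < Suc c then i else Suc i)) = tup (\<lambda>i. f (if i < c then i else Suc i))"
    by (rule fun_nat_eqI) simp_all
  with Bind show ?case by simp
qed simp_all

lemma tsubst_scons_lift: "tsubst (scons V Var) (lift 0 T) = T"
  by (simp add: tsubst_lift)

lemma interp_tsubst: "interp (tsubst f T) \<sigma> = interp T (\<lambda>i. interp (f i) \<sigma>)"
proof (induction T arbitrary: f \<sigma>)
  case (Bind b V T)
  have "(\<lambda>i. interp (tup f i) (up \<sigma>)) = up (\<lambda>i. interp (f i) \<sigma>)"
    by (rule fun_nat_eqI) simp_all
  moreover have "(\<lambda>i. interp (tup f i) (scons v \<sigma>)) = scons v (\<lambda>i. interp (f i) \<sigma>)" for v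
    by (rule fun_nat_eqI) simp_all
  ultimately show ?case by (cases b) (simp_all add: Bind)
qed simp_all

text \<open>Interpretation commutes with \<open>f\<close> on terms and \<open>\<delta>\<close> on
  lambda terms, up to conversion. The two are kept apart because contexts drop definitions: when a
  declaration becomes a definition, \<open>f\<close> is the identity but \<open>\<delta>\<close> is
  not.\<close>

definition smorph ::
  "('s \<Rightarrow> 's) \<Rightarrow> 's env \<Rightarrow> 's env \<Rightarrow> (nat \<Rightarrow> 's trm) \<Rightarrow> (nat \<Rightarrow> 's lam) \<Rightarrow> bool"
where
  "smorph nxt L L' f \<delta> \<longleftrightarrow> morph nxt (ctx L) (ctx L') \<delta> \<and>
    (\<forall>i. conv nxt (ctx L') (sem L' (f i)) (subst \<delta> (env_subst L i)))"

lemma smorph_sem: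
  "smorph nxt L L' f \<delta> \<Longrightarrow> conv nxt (ctx L') (sem L' (tsubst f T)) (subst \<delta> (sem L T))"
  by (simp add: interp_tsubst interp_subst smorph_def interp_conv)

text \<open>A declaration extends both contexts and calls for \<open>up \<delta>\<close>; a
  definition leaves both unchanged, so \<open>\<delta>\<close> itself serves.\<close>

lemma smorph_up:
  assumes "smorph nxt L L' f \<delta>"
  shows "\<exists>\<delta>'. smorph nxt ((b, V) # L) ((b, tsubst f V) # L') (tup f) \<delta>'"
proof (cases b)
  case Dec
  have "conv nxt (ctx ((b, tsubst f V) # L')) (sem ((b, tsubst f V) # L') (tup f i))
      (subst (up \<delta>) (env_subst ((b, V) # L) i))" for i
    using assms Dec by (cases i) (auto simp: smorph_def subst_up_lift intro: conv_refl conv_lift)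
  moreover have "morph nxt (ctx ((b, V) # L)) (ctx ((b, tsubst f V) # L')) (up \<delta>)"
    using assms Dec smorph_sem[OF assms] by (auto simp: smorph_def intro: morph_up)
  ultimately show ?thesis unfolding smorph_def by blast
next
  case Def
  have "conv nxt (ctx ((b, tsubst f V) # L')) (sem ((b, tsubst f V) # L') (tup f i))
      (subst \<delta> (env_subst ((b, V) # L) i))" for i
    using assms Def smorph_sem[OF assms] by (cases i) (auto simp: smorph_def)
  moreover have "morph nxt (ctx ((b, V) # L)) (ctx ((b, tsubst f V) # L')) \<delta>"
    using assms Def by (auto simp: smorph_def)
  ultimately show ?thesis unfolding smorph_def by blast
qed

lemma ty_pow_subst:
  assumes "morph nxt G D \<delta>"
  shows "conv nxt D ((ty nxt D ^^ n) (subst \<delta> t)) (subst \<delta> ((ty nxt G ^^ n) t))"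
proof (induction n)
  case (Suc n)
  from conv_ty[OF Suc] ty_subst[OF assms] show ?case by (auto intro: conv_trans)
qed (simp add: conv_refl)

text \<open>Pushing \<open>f\<close> under a binder requires weakening for \<open>cvalid\<close>, which is itself the instance of this
  lemma for renamings.  The invariant \<open>R\<close> lets one induction serve both.\<close>

lemma cvalid_tsubst_gen:
  assumes "cvalid nxt A L T" and "smorph nxt L L' f \<delta>" and "R L L' f"
    and R_var: "\<And>L L' f i. R L L' f \<Longrightarrow> cvalid nxt A L (Var i) \<Longrightarrow> cvalid nxt A L' (f i)"
    and R_up: "\<And>L L' f b V. R L L' f \<Longrightarrow> cvalid nxt A L' (tsubst f V) \<Longrightarrow>
      R ((b, V) # L) ((b, tsubst f V) # L') (tup f)"
  shows "cvalid nxt A L' (tsubst f T)"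
  using assms(1-3)
proof (induction arbitrary: L' f \<delta> rule: cvalid.induct)
  case (cv_sort L s)
  show ?case by (simp add: cvalid.cv_sort)
next
  case (cv_head K V b)
  from R_var[OF cv_head.prems(2) cvalid.cv_head[OF cv_head.hyps]] show ?case by simp
next
  case (cv_tail K i b V)
  from R_var[OF cv_tail.prems(2) cvalid.cv_tail[OF cv_tail.hyps]] show ?case by simp
next
  case (cv_bind L V b T)
  obtain \<delta>' where \<delta>': "smorph nxt ((b, V) # L) ((b, tsubst f V) # L') (tup f) \<delta>'"
    using smorph_up[OF cv_bind.prems(1)] by blast
  have "cvalid nxt A L' (tsubst f V)" by (rule cv_bind.IH(1)) fact+
  with cv_bind.IH(2)[OF \<delta>'] R_up cv_bind.prems show ?case by (simp add: cvalid.cv_bind)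
next
  case (cv_cast L U T)
  note m = cv_cast.prems(1)
  then have mm: "morph nxt (ctx L) (ctx L') \<delta>" by (simp add: smorph_def)
  have "conv nxt (ctx L') (ty nxt (ctx L') (sem L' (tsubst f T)))
      (ty nxt (ctx L') (subst \<delta> (sem L T)))"
    by (rule conv_ty[OF smorph_sem[OF m]])
  also have "conv nxt (ctx L') \<dots> (subst \<delta> (ty nxt (ctx L) (sem L T)))"
    by (rule ty_subst[OF mm])
  also have "conv nxt (ctx L') \<dots> (subst \<delta> (sem L U))"
    by (rule conv_subst[OF cv_cast.hyps(3) mm])
  also have "conv nxt (ctx L') \<dots> (sem L' (tsubst f U))"
    by (rule conv_sym[OF smorph_sem[OF m]])
  finally show ?case using cv_cast by (auto intro: cvalid.cv_cast)
next
  case (cv_app L V T n w u)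
  note m = cv_app.prems(1)
  then have mm: "morph nxt (ctx L) (ctx L') \<delta>" by (simp add: smorph_def)
  have "conv nxt (ctx L') (ty nxt (ctx L') (sem L' (tsubst f V)))
      (ty nxt (ctx L') (subst \<delta> (sem L V)))"
    by (rule conv_ty[OF smorph_sem[OF m]])
  also have "conv nxt (ctx L') \<dots> (subst \<delta> (ty nxt (ctx L) (sem L V)))"
    by (rule ty_subst[OF mm])
  also have "conv nxt (ctx L') \<dots> (subst \<delta> w)"
    by (rule conv_subst[OF cv_app.hyps(5) mm])
  finally have V: "conv nxt (ctx L') (ty nxt (ctx L') (sem L' (tsubst f V))) (subst \<delta> w)" .
  have "conv nxt (ctx L') ((ty nxt (ctx L') ^^ n) (sem L' (tsubst f T)))
      ((ty nxt (ctx L') ^^ n) (subst \<delta> (sem L T)))"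
    by (rule conv_ty_pow[OF smorph_sem[OF m]])
  also have "conv nxt (ctx L') \<dots> (subst \<delta> ((ty nxt (ctx L) ^^ n) (sem L T)))"
    by (rule ty_pow_subst[OF mm])
  also have "conv nxt (ctx L') \<dots> (subst \<delta> (LLam w u))"
    by (rule conv_subst[OF cv_app.hyps(4) mm])
  finally have "conv nxt (ctx L') ((ty nxt (ctx L') ^^ n) (sem L' (tsubst f T)))
      (LLam (subst \<delta> w) (subst (up \<delta>) u))" by simp
  with cv_app.IH[OF cv_app.prems] cv_app.hyps(3) V show ?case by (simp add: cvalid.cv_app)
qed

lemma morph_LVar: "morph nxt G G LVar"
  by (simp add: morph_def conv_refl)

lemma morph_Suc: "morph nxt G (w # G) (\<lambda>i. LVar (Suc i))"
  by (simp add: morph_def conv_refl flip: ren_as_subst)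

lemma smorph_Suc: "\<exists>\<delta>. smorph nxt K ((b, V) # K) (\<lambda>i. Var (Suc i)) \<delta>"
proof (cases b)
  case Dec
  then have "smorph nxt K ((b, V) # K) (\<lambda>i. Var (Suc i)) (\<lambda>i. LVar (Suc i))"
    by (simp add: smorph_def morph_Suc conv_refl flip: ren_as_subst)
  then show ?thesis by blast
next
  case Def
  then have "smorph nxt K ((b, V) # K) (\<lambda>i. Var (Suc i)) LVar"
    by (simp add: smorph_def morph_LVar conv_refl)
  then show ?thesis by blast
qed

lemma cvalid_lift:
  assumes "cvalid nxt A K T"
  shows "cvalid nxt A ((b, V) # K) (lift 0 T)"
proof -
  \<comment> \<open>Requiring \<open>f\<close> to yield variables makes the lifting of
    \<open>f j\<close> an instance of \<open>cv_tail\<close> instead of the weakening under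
    proof.\<close>
  define R where "R L L' f \<longleftrightarrow> (\<forall>i. cvalid nxt A L (Var i) \<longrightarrow> cvalid nxt A L' (f i)) \<and>
    (\<forall>i. \<exists>j. f i = Var j)" for L L' :: "'a env" and f :: "nat \<Rightarrow> 'a trm"
  obtain \<delta> where "smorph nxt K ((b, V) # K) (\<lambda>i. Var (Suc i)) \<delta>"
    using smorph_Suc by blast
  moreover have "R K ((b, V) # K) (\<lambda>i. Var (Suc i))"
    by (auto simp: R_def intro: cv_tail)
  ultimately have "cvalid nxt A ((b, V) # K) (tsubst (\<lambda>i. Var (Suc i)) T)"
    using assms
  proof (rule_tac cvalid_tsubst_gen[where R = R])
    fix L L' f c W
    assume R: "R L L' f" and W: "cvalid nxt A L' (tsubst f W)"
    have "cvalid nxt A ((c, tsubst f W) # L') (tup f i)"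
      if "cvalid nxt A ((c, W) # L) (Var i)" for i
    proof (cases i)
      case 0
      with W show ?thesis by (simp add: cv_head)
    next
      case (Suc j)
      with that have "cvalid nxt A L (Var j)" by (auto elim: cv_tailE)
      moreover from R obtain k where "f j = Var k" by (auto simp: R_def)
      ultimately show ?thesis using R Suc by (auto simp: R_def intro!: cv_tail)
    qed
    moreover have "\<exists>j. tup f i = Var j" for i
    proof (cases i)
      case (Suc j)
      moreover from R obtain k where "f j = Var k" by (auto simp: R_def)
      ultimately show ?thesis by simp
    qed simp
    ultimately show "R ((c, W) # L) ((c, tsubst f W) # L') (tup f)" by (simp add: R_def)
  qed (auto simp: R_def)
  then show ?thesis by (simp add: lift_as_tsubst)
qed

lemma cvalid_tsubst:
  assumes "cvalid nxt A L T" and "smorph nxt L L' f \<delta>"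
    and "\<And>i. cvalid nxt A L (Var i) \<Longrightarrow> cvalid nxt A L' (f i)"
  shows "cvalid nxt A L' (tsubst f T)"
proof (rule cvalid_tsubst_gen[OF assms(1,2),
      where R = "\<lambda>L L' f. \<forall>i. cvalid nxt A L (Var i) \<longrightarrow> cvalid nxt A L' (f i)"])
  fix L L' f b V
  assume f: "\<forall>i. cvalid nxt A L (Var i) \<longrightarrow> cvalid nxt A L' (f i)"
    and V: "cvalid nxt A L' (tsubst f V)"
  have "cvalid nxt A ((b, tsubst f V) # L') (tup f i)"
    if "cvalid nxt A ((b, V) # L) (Var i)" for i
  proof (cases i)
    case 0
    with V show ?thesis by (simp add: cv_head)
  next
    case (Suc j)
    with that f show ?thesis by (auto elim: cv_tailE intro: cvalid_lift)
  qed
  then show "\<forall>i. cvalid nxt A ((b, V) # L) (Var i) \<longrightarrow>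
      cvalid nxt A ((b, tsubst f V) # L') (tup f i)" by blast
qed (use assms(3) in auto)

text \<open>Strengthening for rule \<open>zeta\<close>: the definiens is substituted for its
  variable, which on lambda terms is the identity.\<close>

lemma cvalid_unlift:
  assumes "cvalid nxt A ((Def, V) # L) (lift 0 T)"
  shows "cvalid nxt A L T"
proof -
  have V: "cvalid nxt A ((Def, V) # L) (Var 0) \<Longrightarrow> cvalid nxt A L V"
    by (auto elim: cv_headE)
  have "conv nxt (ctx L) (sem L (scons V Var i)) (subst LVar (env_subst ((Def, V) # L) i))" for i
    by (cases i) (simp_all add: conv_refl)
  then have "smorph nxt ((Def, V) # L) L (scons V Var) LVar"
    by (simp add: smorph_def morph_LVar)
  moreover have "cvalid nxt A L (scons V Var i)"
    if "cvalid nxt A ((Def, V) # L) (Var i)" for i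
    using that V by (cases i) (auto elim: cv_tailE)
  ultimately have "cvalid nxt A L (tsubst (scons V Var) (lift 0 T))"
    using assms by (blast intro: cvalid_tsubst)
  then show ?thesis by (simp add: tsubst_scons_lift)
qed

text \<open>The identity substitution viewed between environments with different heads; callers
  supply the \<open>\<delta>\<close> that tracks the change.\<close>

lemma cvalid_entry:
  assumes "cvalid nxt A ((b, V) # L) T" and "cvalid nxt A L V'"
    and "smorph nxt ((b, V) # L) ((b', V') # L) Var \<delta>"
  shows "cvalid nxt A ((b', V') # L) T"
proof -
  have "cvalid nxt A ((b', V') # L) (Var i)" if "cvalid nxt A ((b, V) # L) (Var i)" for i
    using that assms(2) by (cases i) (auto elim: cv_tailE intro: cv_head cv_tail)
  with cvalid_tsubst[OF assms(1,3)] show ?thesis by simp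
qed

lemma cvalid_entry_conv:
  assumes "cvalid nxt A ((b, V) # L) T" and "cvalid nxt A L V'"
    and "conv nxt (ctx L) (sem L V) (sem L V')"
  shows "cvalid nxt A ((b, V') # L) T"
  using assms(1,2)
proof (rule cvalid_entry)
  have "conv nxt (ctx L) (scons (sem L V') (env_subst L) i) (scons (sem L V) (env_subst L) i)" for i
    using assms(3) by (cases i) (auto intro: conv_refl conv_sym)
  then show "smorph nxt ((b, V) # L) ((b, V') # L) Var LVar"
    using assms(3)
    by (cases b) (simp_all add: smorph_def morph_conv_hd morph_LVar conv_refl)
qed

text \<open>The change of environment behind rule \<open>beta\<close>: on lambda terms it
  substitutes the argument, which is a morphism because the redex is safe.\<close>

lemma cvalid_entry_beta:
  assumes "cvalid nxt A ((Dec, W) # L) T" and "cvalid nxt A L (Cast W V)"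
    and "conv nxt (ctx L) (ty nxt (ctx L) (sem L V)) (sem L W)"
  shows "cvalid nxt A ((Def, Cast W V) # L) T"
  using assms(1,2)
proof (rule cvalid_entry)
  have "conv nxt (ctx L) (scons (sem L V) (env_subst L) i) (inst (sem L V) (up (env_subst L) i))" for i
    by (cases i) (auto intro: conv_refl)
  then show "smorph nxt ((Dec, W) # L) ((Def, Cast W V) # L) Var (scons (sem L V) LVar)"
    using assms(3) by (simp add: smorph_def morph_inst)
qed

section \<open>Preservation of \<open>cvalid\<close> under rt-reduction\<close>

lemma ty_pow_lift: "(ty nxt (w # G) ^^ n) (ren Suc t) = ren Suc ((ty nxt G ^^ n) t)"
  by (induction n) (simp_all add: ty_lift)

lemma ty_pow_app [simp]: "(ty nxt G ^^ n) (LApp v t) = LApp v ((ty nxt G ^^ n) t)"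
  by (induction n) simp_all

lemma ty_pow_lam [simp]: "(ty nxt G ^^ n) (LLam w t) = LLam w ((ty nxt (w # G) ^^ n) t)"
  by (induction n) simp_all

lemma sem_beta: "sem ((Def, V) # L) T = inst (sem L V) (sem ((Dec, W) # L) T)"
proof -
  have "(\<lambda>i. inst (sem L V) (up (env_subst L) i)) = scons (sem L V) (env_subst L)"
    by (rule fun_nat_eqI) simp_all
  then show ?thesis by (simp add: interp_subst)
qed

text \<open>Preservation needs simulation by \<open>ty\<close>: the conversion between the old and
  the new interpretation is what transports the side conditions of casts and applications.\<close>

lemma cvalid_step:
  assumes "rt_step nxt L n T T'" and "cvalid nxt A L T"
  shows "cvalid nxt A L T' \<and> conv nxt (ctx L) ((ty nxt (ctx L) ^^ n) (sem L T)) (sem L T')"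
  using assms
proof (induction rule: rt_step.induct)
  case (beta L V W T)
  from beta obtain n w u where V: "cvalid nxt A L V" and "cvalid nxt A L (Lam W T)"
    and n: "conv nxt (ctx L) ((ty nxt (ctx L) ^^ n) (sem L (Lam W T))) (LLam w u)"
    and w: "conv nxt (ctx L) (ty nxt (ctx L) (sem L V)) w"
    by (auto elim: cv_appE)
  then have W: "cvalid nxt A L W" and T: "cvalid nxt A ((Dec, W) # L) T"
    by (auto elim: cv_bindE)
  \<comment> \<open>Iterating \<open>ty\<close> on an abstraction keeps its domain, so
    \<open>W\<close> is compared with \<open>w\<close> whatever \<open>n\<close> is.\<close>
  from n have "conv nxt (ctx L) (sem L W) w" by (auto intro: conv_lamD)
  with w have c: "conv nxt (ctx L) (ty nxt (ctx L) (sem L V)) (sem L W)"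
    by (meson conv_sym conv_trans)
  with V W have "cvalid nxt A L (Cast W V)" by (simp add: cv_cast)
  moreover from T this c have "cvalid nxt A ((Def, Cast W V) # L) T"
    by (rule cvalid_entry_beta)
  moreover have "conv nxt (ctx L) (sem L (App V (Lam W T))) (sem L (LDef (Cast W V) T))"
    using conv_beta[OF c, of "sem ((Dec, W) # L) T"]
      sem_beta[where V = V and L = L and T = T and W = W] by simp
  ultimately show ?case by (simp add: cv_bind)
next
  case (delta V K)
  then show ?case by (auto elim: cv_headE intro: cvalid_lift conv_refl)
next
  case (zeta L V T)
  then show ?case by (auto elim!: cv_bindE intro: cvalid_unlift conv_refl)
next
  case (theta L V W T)
  then obtain n w u where V: "cvalid nxt A L V" and "cvalid nxt A L (LDef W T)" "n \<in> A"
    and n: "conv nxt (ctx L) ((ty nxt (ctx L) ^^ n) (sem L (LDef W T))) (LLam w u)"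
    and w: "conv nxt (ctx L) (ty nxt (ctx L) (sem L V)) w"
    by (auto elim: cv_appE)
  moreover from this have "cvalid nxt A L W" "cvalid nxt A ((Def, W) # L) T"
    by (auto elim: cv_bindE)
  \<comment> \<open>A definition does not extend \<open>ctx\<close> and is unfolded by
    \<open>sem\<close>, so \<open>n\<close>, \<open>w\<close>, \<open>u\<close> and both conversions
    carry over.\<close>
  ultimately have "cvalid nxt A L (LDef W (App (lift 0 V) T))"
    by (intro cv_bind cv_app[of _ _ _ _ _ n w u]) (auto intro: cvalid_lift)
  then show ?case by (simp add: conv_refl)
next
  case (cast_term L U T)
  then show ?case by (auto elim: cv_castE intro: conv_refl)
next
  case (sort L s)
  then show ?case by (simp add: cv_sort conv_refl)
next
  case (decl W K)
  then show ?case by (auto elim: cv_headE intro: cvalid_lift conv_refl)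
next
  case (cast_type L U T)
  then show ?case by (auto elim: cv_castE)
next
  case (weaken K n i T b V)
  then have "cvalid nxt A K (Var i)" by (auto elim: cv_tailE)
  with weaken.IH have T: "cvalid nxt A K T"
    and c: "conv nxt (ctx K) ((ty nxt (ctx K) ^^ n) (env_subst K i)) (sem K T)" by simp_all
  show ?case
    using cvalid_lift[OF T] c conv_lift[OF c] by (cases b) (simp_all add: ty_pow_lift)
next
  case (app_arg L V1 V2 T)
  then obtain n w u where V: "cvalid nxt A L V1" and "cvalid nxt A L T" "n \<in> A"
    and n: "conv nxt (ctx L) ((ty nxt (ctx L) ^^ n) (sem L T)) (LLam w u)"
    and w: "conv nxt (ctx L) (ty nxt (ctx L) (sem L V1)) w"
    by (auto elim: cv_appE)
  from app_arg.IH[OF V] have V2: "cvalid nxt A L V2"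
    and c: "conv nxt (ctx L) (sem L V1) (sem L V2)" by simp_all
  from conv_ty[OF c] w have "conv nxt (ctx L) (ty nxt (ctx L) (sem L V2)) w"
    by (meson conv_sym conv_trans)
  with V2 \<open>cvalid nxt A L T\<close> \<open>n \<in> A\<close> n have "cvalid nxt A L (App V2 T)"
    by (rule cv_app)
  with c show ?case by (simp add: conv_app conv_refl)
next
  case (app_fun L k T1 T2 V)
  then obtain n w u where V: "cvalid nxt A L V" and T1: "cvalid nxt A L T1" and "n \<in> A"
    and n: "conv nxt (ctx L) ((ty nxt (ctx L) ^^ n) (sem L T1)) (LLam w u)"
    and w: "conv nxt (ctx L) (ty nxt (ctx L) (sem L V)) w"
    by (auto elim: cv_appE)
  let ?G = "ctx L"
  from app_fun.IH[OF T1] have T2: "cvalid nxt A L T2"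
    and c: "conv nxt ?G ((ty nxt ?G ^^ k) (sem L T1)) (sem L T2)" by simp_all
  \<comment> \<open>The same \<open>n\<close> works for \<open>T2\<close>: applying
    \<open>ty\<close> another \<open>k\<close> times to \<open>LLam w u\<close> changes only the
    body.\<close>
  have "conv nxt ?G ((ty nxt ?G ^^ n) (sem L T2)) ((ty nxt ?G ^^ n) ((ty nxt ?G ^^ k) (sem L T1)))"
    by (rule conv_sym[OF conv_ty_pow[OF c]])
  also have "\<dots> = (ty nxt ?G ^^ k) ((ty nxt ?G ^^ n) (sem L T1))"
    by (metis add.commute comp_apply funpow_add)
  also have "conv nxt ?G \<dots> ((ty nxt ?G ^^ k) (LLam w u))"
    by (rule conv_ty_pow[OF n])
  finally have "conv nxt ?G ((ty nxt ?G ^^ n) (sem L T2)) (LLam w ((ty nxt (w # ?G) ^^ k) u))"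
    by simp
  with V T2 \<open>n \<in> A\<close> have "cvalid nxt A L (App V T2)" using w by (rule cv_app)
  with c show ?case by (simp add: conv_app conv_refl)
next
  case (bind_entry L V1 V2 b T)
  then have V: "cvalid nxt A L V1" and T: "cvalid nxt A ((b, V1) # L) T"
    by (auto elim: cv_bindE)
  from bind_entry.IH[OF V] have V2: "cvalid nxt A L V2"
    and c: "conv nxt (ctx L) (sem L V1) (sem L V2)" by simp_all
  from V2 cvalid_entry_conv[OF T V2 c] have "cvalid nxt A L (Bind b V2 T)" by (rule cv_bind)
  moreover have "conv nxt (ctx L) (sem L (Bind b V1 T)) (sem L (Bind b V2 T))"
  proof (cases b)
    case Dec
    with c show ?thesis by (simp add: conv_lam conv_refl)
  next
    case Def
    have "conv nxt (ctx L) (scons (sem L V1) (env_subst L) i) (scons (sem L V2) (env_subst L) i)" for i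
      using c by (cases i) (auto intro: conv_refl)
    with Def show ?thesis by (simp add: interp_conv)
  qed
  ultimately show ?case by simp
next
  case (bind_body b V L n T1 T2)
  then show ?case
    by (cases b) (auto elim!: cv_bindE intro: cv_bind conv_lam conv_refl)
next
  case (cast_left L U1 U2 T)
  then have U1: "cvalid nxt A L U1" and T: "cvalid nxt A L T"
    and t: "conv nxt (ctx L) (ty nxt (ctx L) (sem L T)) (sem L U1)"
    by (auto elim: cv_castE)
  from cast_left.IH[OF U1] t have "cvalid nxt A L U2"
    "conv nxt (ctx L) (ty nxt (ctx L) (sem L T)) (sem L U2)"
    by (auto intro: conv_trans)
  with T show ?case by (simp add: cv_cast conv_refl)
next
  case (cast_right L T1 T2 U)
  then have U: "cvalid nxt A L U" and T1: "cvalid nxt A L T1"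
    and t: "conv nxt (ctx L) (ty nxt (ctx L) (sem L T1)) (sem L U)"
    by (auto elim: cv_castE)
  from cast_right.IH[OF T1] have T2: "cvalid nxt A L T2"
    and c: "conv nxt (ctx L) (sem L T1) (sem L T2)" by simp_all
  from conv_ty[OF c] t have "conv nxt (ctx L) (ty nxt (ctx L) (sem L T2)) (sem L U)"
    by (meson conv_sym conv_trans)
  with U T2 c show ?case by (simp add: cv_cast)
next
  case (cast_both L U1 U2 T1 T2)
  then have U1: "cvalid nxt A L U1" and T1: "cvalid nxt A L T1"
    and t: "conv nxt (ctx L) (ty nxt (ctx L) (sem L T1)) (sem L U1)"
    by (auto elim: cv_castE)
  from cast_both.IH(1)[OF U1] have U2: "cvalid nxt A L U2"
    and cU: "conv nxt (ctx L) (ty nxt (ctx L) (sem L U1)) (sem L U2)" by simp_all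
  from cast_both.IH(2)[OF T1] have T2: "cvalid nxt A L T2"
    and cT: "conv nxt (ctx L) (ty nxt (ctx L) (sem L T1)) (sem L T2)" by simp_all
  have "conv nxt (ctx L) (ty nxt (ctx L) (sem L T2)) (sem L U2)"
    using conv_ty[OF cT] conv_ty[OF t] cU by (meson conv_sym conv_trans)
  with U2 T2 cT show ?case by (simp add: cv_cast)
qed

lemma cvalid_steps:
  assumes "rt_steps nxt L n T T'" and "cvalid nxt A L T"
  shows "cvalid nxt A L T' \<and> conv nxt (ctx L) ((ty nxt (ctx L) ^^ n) (sem L T)) (sem L T')"
  using assms
proof (induction rule: rt_steps.induct)
  case (refl L T)
  then show ?case by (simp add: conv_refl)
next
  case (step L n T1 T2)
  then show ?case by (rule cvalid_step)
next
  case (trans L n1 T1 T n2 T2)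
  let ?G = "ctx L"
  from trans have T: "cvalid nxt A L T" "cvalid nxt A L T2"
    and c1: "conv nxt ?G ((ty nxt ?G ^^ n1) (sem L T1)) (sem L T)"
    and c2: "conv nxt ?G ((ty nxt ?G ^^ n2) (sem L T)) (sem L T2)" by simp_all
  have "(ty nxt ?G ^^ (n1 + n2)) (sem L T1) = (ty nxt ?G ^^ n2) ((ty nxt ?G ^^ n1) (sem L T1))"
    by (metis add.commute comp_apply funpow_add)
  with conv_trans[OF conv_ty_pow[OF c1] c2] T show ?case by simp
qed

text \<open>Each reduction in a side condition starts from a term that is \<open>cvalid\<close> by
  induction, so \<open>cvalid_steps\<close> turns it into a conversion.\<close>

lemma valid_imp_cvalid: "valid nxt A L T \<Longrightarrow> cvalid nxt A L T"
proof (induction rule: valid.induct)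
  case (cast L U T U0)
  from cvalid_steps[OF cast.hyps(3) cast.IH(2)] cvalid_steps[OF cast.hyps(4) cast.IH(1)]
  have "conv nxt (ctx L) (ty nxt (ctx L) (sem L T)) (sem L U)"
    by (auto intro: conv_trans conv_sym)
  with cast.IH show ?case by (rule cv_cast)
next
  case (app L V T n W0 U0)
  from cvalid_steps[OF app.hyps(4) app.IH(2)] cvalid_steps[OF app.hyps(5) app.IH(1)]
  have "conv nxt (ctx L) ((ty nxt (ctx L) ^^ n) (sem L T)) (LLam (sem L W0) (sem ((Dec, W0) # L) U0))"
    "conv nxt (ctx L) (ty nxt (ctx L) (sem L V)) (sem L W0)" by simp_all
  with app.IH app.hyps(3) show ?case by (rule cv_app)
qed (simp_all add: cvalid.intros)

lemma cvalid_type: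
  "cvalid nxt A L T \<Longrightarrow>
    \<exists>U. cvalid nxt A L U \<and> conv nxt (ctx L) (ty nxt (ctx L) (sem L T)) (sem L U)"
proof (induction rule: cvalid.induct)
  case (cv_sort L s)
  have "cvalid nxt A L (Sort (nxt s))" by (rule cvalid.cv_sort)
  then show ?case by (force intro: conv_refl)
next
  case (cv_head K V b)
  show ?case
  proof (cases b)
    case Dec
    have "cvalid nxt A ((b, V) # K) (lift 0 V)" by (rule cvalid_lift) fact
    with Dec show ?thesis by (force intro: conv_refl)
  next
    case Def
    \<comment> \<open>A defined variable has the interpretation of its definiens, hence also its
      type.\<close>
    from cv_head.IH obtain U where "cvalid nxt A K U"
      "conv nxt (ctx K) (ty nxt (ctx K) (sem K V)) (sem K U)" by blast
    with Def cvalid_lift[OF this(1), of b V] show ?thesis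
      by (intro exI[of _ "lift 0 U"]) simp
  qed
next
  case (cv_tail K i b V)
  then obtain U where U: "cvalid nxt A K U"
    "conv nxt (ctx K) (ty nxt (ctx K) (sem K (Var i))) (sem K U)" by blast
  with cvalid_lift[OF U(1), of b V] conv_lift[OF U(2)] show ?case
    by (intro exI[of _ "lift 0 U"]) (cases b; simp add: ty_lift)
next
  case (cv_bind L V b T)
  then obtain U where "cvalid nxt A ((b, V) # L) U"
    "conv nxt (ctx ((b, V) # L)) (ty nxt (ctx ((b, V) # L)) (sem ((b, V) # L) T))
      (sem ((b, V) # L) U)" by blast
  with cv_bind.hyps(1) show ?case
    by (intro exI[of _ "Bind b V U"])
      (cases b; simp add: cvalid.cv_bind conv_lam conv_refl)
next
  case (cv_cast L U T)
  then show ?case by auto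
next
  case (cv_app L V T n w u)
  let ?G = "ctx L"
  from cv_app.IH(2) obtain U where U: "cvalid nxt A L U"
    and c: "conv nxt ?G (ty nxt ?G (sem L T)) (sem L U)" by blast
  have "conv nxt ?G ((ty nxt ?G ^^ n) (sem L U)) ((ty nxt ?G ^^ n) (ty nxt ?G (sem L T)))"
    by (rule conv_sym[OF conv_ty_pow[OF c]])
  also have "\<dots> = ty nxt ?G ((ty nxt ?G ^^ n) (sem L T))"
    by (simp add: funpow_swap1)
  also have "conv nxt ?G \<dots> (ty nxt ?G (LLam w u))"
    by (rule conv_ty[OF cv_app.hyps(4)])
  finally have "conv nxt ?G ((ty nxt ?G ^^ n) (sem L U)) (LLam w (ty nxt (w # ?G) u))"
    by simp
  with cv_app.hyps(1) U cv_app.hyps(3) have "cvalid nxt A L (App V U)"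
    using cv_app.hyps(5) by (rule cvalid.cv_app)
  with c show ?case by (intro exI[of _ "App V U"]) (simp add: conv_app conv_refl)
qed

subsection \<open>Realizing conversions by rt-reduction\<close>

text \<open>Weakening of reduction has to pass below the entries that \<open>bind_body\<close> adds,
  hence insertion at an arbitrary depth \<open>c\<close>.\<close>

inductive env_ins :: "nat \<Rightarrow> 's env \<Rightarrow> 's env \<Rightarrow> bool" where
  env_ins_0: "env_ins 0 K (e # K)"
| env_ins_Suc: "env_ins c K K' \<Longrightarrow> env_ins (Suc c) ((b, V) # K) ((b, lift c V) # K')"

lemma lift_lift: "c \<le> d \<Longrightarrow> lift (Suc d) (lift c T) = lift c (lift d T)"
  by (induction T arbitrary: c d) auto

lemma rt_step_env_ins:
  assumes "rt_step nxt L n T T'" and "env_ins c L L'"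
  shows "rt_step nxt L' n (lift c T) (lift c T')"
  using assms
proof (induction arbitrary: c L' rule: rt_step.induct)
  case (delta V K)
  from delta show ?case
  proof (cases rule: env_ins.cases)
    case (env_ins_0 e)
    obtain b V' where "e = (b, V')" by force
    with env_ins_0 rt_step.weaken[OF rt_step.delta] show ?thesis by simp
  qed (simp add: lift_lift rt_step.delta)
next
  case (decl W K)
  from decl show ?case
  proof (cases rule: env_ins.cases)
    case (env_ins_0 e)
    obtain b V' where "e = (b, V')" by force
    with env_ins_0 rt_step.weaken[OF rt_step.decl] show ?thesis by simp
  qed (simp add: lift_lift rt_step.decl[unfolded One_nat_def])
next
  case (weaken K n i T b V)
  from weaken.prems show ?case
  proof (cases rule: env_ins.cases)
    case (env_ins_0 e)
    obtain b' V' where "e = (b', V')" by force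
    with env_ins_0 rt_step.weaken[OF rt_step.weaken[OF weaken.hyps]] show ?thesis by simp
  next
    case (env_ins_Suc d K')
    have "rt_step nxt K' n (Var (if i < d then i else Suc i)) (lift d T)"
      using weaken.IH[OF env_ins_Suc(3)] by simp
    from rt_step.weaken[OF this, of b "lift d V"] env_ins_Suc
    show ?thesis by (simp add: lift_lift split: if_splits)
  qed
qed (simp_all add: lift_lift rt_step.intros[unfolded One_nat_def] env_ins_Suc)

lemma rt_steps_lift:
  "rt_steps nxt K n T T' \<Longrightarrow> rt_steps nxt (e # K) n (lift 0 T) (lift 0 T')"
proof (induction rule: rt_steps.induct)
  case (step L n T1 T2)
  from rt_step_env_ins[OF step env_ins_0] show ?case by (rule rt_steps.step)
qed (auto intro: rt_steps.refl rt_steps.trans)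

lemma rt_steps_trans0:
  assumes "rt_steps nxt L 0 T1 T" and "rt_steps nxt L n T T2"
  shows "rt_steps nxt L n T1 T2"
  using rt_steps.trans[OF assms] by simp

text \<open>The premise \<open>n = 0\<close> keeps the index a variable for the induction;
  transitivity splits it into two zeros.\<close>

lemma rt_steps_app_arg:
  "rt_steps nxt L n V1 V2 \<Longrightarrow> n = 0 \<Longrightarrow> rt_steps nxt L 0 (App V1 T) (App V2 T)"
  by (induction rule: rt_steps.induct)
    (auto intro: rt_steps.refl rt_steps.step rt_step.app_arg rt_steps_trans0)

lemma rt_steps_app_fun:
  "rt_steps nxt L n T1 T2 \<Longrightarrow> rt_steps nxt L n (App V T1) (App V T2)"
  by (induction rule: rt_steps.induct)
    (auto intro: rt_steps.refl rt_steps.step rt_step.app_fun rt_steps.trans)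

lemma rt_steps_bind_entry:
  "rt_steps nxt L n V1 V2 \<Longrightarrow> n = 0 \<Longrightarrow> rt_steps nxt L 0 (Bind b V1 T) (Bind b V2 T)"
  by (induction rule: rt_steps.induct)
    (auto intro: rt_steps.refl rt_steps.step rt_step.bind_entry rt_steps_trans0)

lemma rt_steps_bind_body:
  "rt_steps nxt ((b, V) # L) n T1 T2 \<Longrightarrow> rt_steps nxt L n (Bind b V T1) (Bind b V T2)"
  by (induction "(b, V) # L" n T1 T2 rule: rt_steps.induct)
    (auto intro: rt_steps.refl rt_steps.step rt_step.bind_body rt_steps.trans)

lemma rt_steps_app:
  "rt_steps nxt L 0 V1 V2 \<Longrightarrow> rt_steps nxt L 0 T1 T2 \<Longrightarrow>
    rt_steps nxt L 0 (App V1 T1) (App V2 T2)"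
  by (rule rt_steps_trans0[OF rt_steps_app_arg[OF _ HOL.refl] rt_steps_app_fun])

lemma rt_steps_bind:
  "rt_steps nxt L 0 V1 V2 \<Longrightarrow> rt_steps nxt ((b, V1) # L) 0 T1 T2 \<Longrightarrow>
    rt_steps nxt L 0 (Bind b V1 T1) (Bind b V2 T2)"
  by (rule rt_steps_trans0[OF rt_steps_bind_body rt_steps_bind_entry[OF _ HOL.refl]])

section \<open>Reading lambda terms back as terms\<close>

primrec embed :: "(nat \<Rightarrow> nat) \<Rightarrow> 's lam \<Rightarrow> 's trm" where
  "embed r (LSort s) = Sort s"
| "embed r (LVar i) = Var (r i)"
| "embed r (LApp v t) = App (embed r v) (embed r t)"
| "embed r (LLam w t) = Lam (embed r w) (embed (upr r) t)"

text \<open>\<open>dec_index L\<close> maps the indices of \<open>ctx L\<close>, which has no definitions, to those of \<open>L\<close>.\<close>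

fun dec_index :: "'s env \<Rightarrow> nat \<Rightarrow> nat" where
  "dec_index [] = (\<lambda>i. i)"
| "dec_index ((Dec, W) # K) = upr (dec_index K)"
| "dec_index ((Def, V) # K) = (\<lambda>i. Suc (dec_index K i))"

abbreviation embed_env :: "'s env \<Rightarrow> 's lam \<Rightarrow> 's trm" where
  "embed_env L \<equiv> embed (dec_index L)"

lemma lift_embed: "lift c (embed r t) = embed (\<lambda>i. if r i < c then r i else Suc (r i)) t"
proof (induction t arbitrary: c r)
  case (LLam w t)
  have "(\<lambda>i. if upr r i < Suc c then upr r i else Suc (upr r i))
      = upr (\<lambda>i. if r i < c then r i else Suc (r i))"
    by (rule fun_nat_eqI) simp_all
  with LLam show ?case by simp
qed simp_all

lemma embed_ren: "embed r (ren r' t) = embed (\<lambda>i. r (r' i)) t"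
proof (induction t arbitrary: r r')
  case (LLam w t)
  have "(\<lambda>i. upr r (upr r' i)) = upr (\<lambda>i. r (r' i))"
    by (rule fun_nat_eqI) simp_all
  with LLam show ?case by simp
qed simp_all

lemma interp_embed: "interp (embed r t) \<sigma> = subst (\<lambda>i. \<sigma> (r i)) t"
proof (induction t arbitrary: r \<sigma>)
  case (LLam w t)
  have "(\<lambda>i. up \<sigma> (upr r i)) = up (\<lambda>i. \<sigma> (r i))"
    by (rule fun_nat_eqI) simp_all
  with LLam show ?case by simp
qed simp_all

lemma env_subst_dec_index: "env_subst L (dec_index L i) = LVar i"
proof (induction L arbitrary: i rule: env_subst.induct)
  case (2 W K)
  then show ?case by (cases i) simp_all
qed simp_all

lemma sem_embed [simp]: "sem L (embed_env L t) = t"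
  by (simp add: interp_embed env_subst_dec_index)

lemma sem_embed_inst: "interp (embed (upr (dec_index L)) t) (scons v (env_subst L)) = inst v t"
proof -
  have "(\<lambda>i. scons v (env_subst L) (upr (dec_index L) i)) = scons v LVar"
    by (rule fun_nat_eqI) (simp_all add: env_subst_dec_index)
  then show ?thesis by (simp add: interp_embed)
qed

lemma embed_env_Def: "embed_env ((Def, V) # L) t = lift 0 (embed_env L t)"
  by (simp add: lift_embed)

lemma embed_env_Dec: "embed_env ((Dec, W) # L) (ren Suc t) = lift 0 (embed_env L t)"
  by (simp add: lift_embed embed_ren)

text \<open>Expanding a defined variable needs its definiens in the shorter environment, while
  expanding under a binder needs the variables of the longer one. Assuming both separates the
  induction on terms from that on environments.\<close>

lemma expand_var_Cons:
  assumes "\<And>i. rt_steps nxt L 0 (Var i) (embed_env L (env_subst L i))"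
    and "rt_steps nxt L 0 V (embed_env L (sem L V))"
  shows "rt_steps nxt ((b, V) # L) 0 (Var i) (embed_env ((b, V) # L) (env_subst ((b, V) # L) i))"
proof (cases i)
  case 0
  show ?thesis
  proof (cases b)
    case Dec
    with 0 show ?thesis by (simp add: rt_steps.refl)
  next
    case Def
    have "rt_steps nxt ((Def, V) # L) 0 (Var 0) (lift 0 (embed_env L (sem L V)))"
      by (rule rt_steps_trans0[OF rt_steps.step[OF rt_step.delta] rt_steps_lift[OF assms(2)]])
    with 0 Def show ?thesis by (simp only: embed_env_Def env_subst.simps scons.simps)
  qed
next
  case (Suc j)
  have "rt_steps nxt ((b, V) # L) 0 (Var (Suc j)) (lift 0 (embed_env L (env_subst L j)))"
    using rt_steps_lift[OF assms(1)] by simp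
  with Suc show ?thesis
    by (cases b) (simp_all only: embed_env_Def embed_env_Dec env_subst.simps scons.simps up_simps)
qed

lemma expand_if_var:
  "(\<And>i. rt_steps nxt L 0 (Var i) (embed_env L (env_subst L i))) \<Longrightarrow>
    rt_steps nxt L 0 T (embed_env L (sem L T))"
proof (induction T arbitrary: L)
  case (Bind b V T)
  have V: "rt_steps nxt L 0 V (embed_env L (sem L V))"
    by (rule Bind.IH(1)[OF Bind.prems])
  have "rt_steps nxt ((b, V) # L) 0 T (embed_env ((b, V) # L) (sem ((b, V) # L) T))"
    by (rule Bind.IH(2)[OF expand_var_Cons[OF Bind.prems V]])
  then have "rt_steps nxt L 0 (Bind b V T)
      (Bind b (embed_env L (sem L V)) (embed_env ((b, V) # L) (sem ((b, V) # L) T)))"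
    by (rule rt_steps_bind[OF V])
  then show ?case
  proof (cases b)
    case Def
    assume "rt_steps nxt L 0 (Bind b V T)
      (Bind b (embed_env L (sem L V)) (embed_env ((b, V) # L) (sem ((b, V) # L) T)))"
    \<comment> \<open>The expanded body has the form \<open>lift 0\<close>, so \<open>zeta\<close>
      discards the definition.\<close>
    with Def show ?thesis
      by (simp only: embed_env_Def)
        (simp add: rt_steps_trans0[OF _ rt_steps.step[OF rt_step.zeta]])
  qed simp
next
  case (Cast U T)
  have "rt_steps nxt L 0 (Cast U T) T" by (rule rt_steps.step[OF rt_step.cast_term])
  with Cast show ?case by (auto intro: rt_steps_trans0)
qed (auto intro: rt_steps.refl rt_steps_app)

text \<open>Interpretation is itself a reduction of weight 0: \<open>delta\<close> and
  \<open>zeta\<close> unfold definitions, \<open>cast_term\<close> erases casts.\<close>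

lemma expand: "rt_steps nxt L 0 T (embed_env L (sem L T))"
proof (rule expand_if_var)
  show "rt_steps nxt L 0 (Var i) (embed_env L (env_subst L i))" for i
  proof (induction L arbitrary: i)
    case Nil
    show ?case by (simp add: rt_steps.refl)
  next
    case (Cons e L)
    obtain b V where "e = (b, V)" by force
    with expand_var_Cons[OF Cons expand_if_var[OF Cons]] show ?case by simp
  qed
qed

lemma par_rt_steps:
  "par nxt' G t t' \<Longrightarrow> rt_steps nxt L 0 (embed_env L t) (embed_env L t')"
proof (induction arbitrary: L rule: par.induct)
  case (par_lam G w w' t t')
  have "rt_steps nxt L 0 (embed_env L w) (embed_env L w')" by (rule par_lam.IH(1))
  from rt_steps_bind[OF this par_lam.IH(2)[of "(Dec, embed_env L w) # L"]] show ?case by simp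
next
  case (par_beta G v w v' t t')
  let ?T = "embed (upr (dec_index L))"
  have "rt_steps nxt L 0 (Lam (embed_env L w) (?T t)) (Lam (embed_env L w) (?T t'))"
    using rt_steps_bind_body[OF par_beta.IH(2)[of "(Dec, embed_env L w) # L"]] by simp
  from rt_steps_app[OF par_beta.IH(1) this]
  have "rt_steps nxt L 0 (embed_env L (LApp v (LLam w t)))
      (App (embed_env L v') (Lam (embed_env L w) (?T t')))" by simp
  \<comment> \<open>Rule \<open>beta\<close> leaves a local definition of a cast;
    \<open>expand\<close> removes both, and the interpretation of the result is
    \<open>inst v' t'\<close>.\<close>
  also note rt_steps.step[OF rt_step.beta]
  also (rt_steps_trans0) note expand
  finally (rt_steps_trans0) show ?case by (simp add: sem_embed_inst)
qed (auto intro: rt_steps.refl rt_steps_app)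

lemma pars_rt_steps:
  "pars nxt' G t t' \<Longrightarrow> rt_steps nxt L 0 (embed_env L t) (embed_env L t')"
  by (induction rule: rtranclp_induct) (auto intro: rt_steps.refl rt_steps_trans0 par_rt_steps)

text \<open>Where \<open>ty\<close> meets an undeclared head variable it does not correspond to an rt-step.\<close>

inductive head_declared :: "'s lam list \<Rightarrow> 's lam \<Rightarrow> bool" where
  head_declared_sort: "head_declared G (LSort s)"
| head_declared_head: "head_declared G w \<Longrightarrow> head_declared (w # G) (LVar 0)"
| head_declared_tail: "head_declared G (LVar i) \<Longrightarrow> head_declared (w # G) (LVar (Suc i))"
| head_declared_app: "head_declared G t \<Longrightarrow> head_declared G (LApp v t)"
| head_declared_lam: "head_declared G w \<Longrightarrow> head_declared (w # G) t \<Longrightarrow> head_declared G (LLam w t)"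

inductive_cases head_declared_tailE: "head_declared (w # G) (LVar (Suc i))"
inductive_cases head_declared_appE: "head_declared G (LApp v t)"
inductive_cases head_declared_lamE: "head_declared G (LLam w t)"

lemma head_declared_ren:
  assumes "head_declared G t" and "\<And>i. head_declared G (LVar i) \<Longrightarrow> head_declared D (LVar (r i))"
  shows "head_declared D (ren r t)"
  using assms
proof (induction arbitrary: D r rule: head_declared.induct)
  case (head_declared_head G w)
  from head_declared_head.prems[OF head_declared.head_declared_head[OF head_declared_head.hyps]] show ?case by simp
next
  case (head_declared_tail G i w)
  from head_declared_tail.prems[OF head_declared.head_declared_tail[OF head_declared_tail.hyps]] show ?case by simp
next
  case (head_declared_lam G w t)
  have w: "head_declared D (ren r w)" by (rule head_declared_lam.IH(1)[OF head_declared_lam.prems])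
  have "head_declared (ren r w # D) (LVar (upr r i))" if "head_declared (w # G) (LVar i)" for i
    using that w head_declared_lam.prems by (cases i) (auto elim: head_declared_tailE intro: head_declared.intros)
  from head_declared.head_declared_lam[OF w head_declared_lam.IH(2)[OF this]] show ?case by simp
qed (auto intro: head_declared.intros)

lemma head_declared_lift: "head_declared G t \<Longrightarrow> head_declared (w # G) (ren Suc t)"
  by (rule head_declared_ren) (auto intro: head_declared_tail)

text \<open>\<open>head_declared_head\<close> demands the property of the declared type too, so it
  survives when \<open>ty\<close> replaces the head variable by its type.\<close>

lemma head_declared_ty: "head_declared G t \<Longrightarrow> head_declared G (ty nxt G t)"
  by (induction rule: head_declared.induct) (auto intro: head_declared.intros head_declared_lift)

lemma head_declared_ty_pow: "head_declared G t \<Longrightarrow> head_declared G ((ty nxt G ^^ n) t)"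
  by (induction n) (auto intro: head_declared_ty)

lemma cvalid_head_declared: "cvalid nxt A L T \<Longrightarrow> head_declared (ctx L) (sem L T)"
proof (induction rule: cvalid.induct)
  case (cv_head K V b)
  then show ?case by (cases b) (auto intro: head_declared.intros)
next
  case (cv_tail K i b V)
  then show ?case by (cases b) (auto intro: head_declared_lift)
next
  case (cv_bind L V b T)
  then show ?case by (cases b) (auto intro: head_declared.intros)
qed (auto intro: head_declared.intros)

lemma head_declared_var_rt_steps:
  "head_declared (ctx L) (LVar i) \<Longrightarrow> rt_steps nxt L 1 (Var (dec_index L i)) (embed_env L (look (ctx L) i))"
proof (induction L arbitrary: i)
  case Nil
  then show ?case by (auto elim: head_declared.cases)
next
  case (Cons e L)
  obtain b V where e: "e = (b, V)" by force
  show ?case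
  proof (cases b)
    case Def
    with Cons e have "rt_steps nxt L 1 (Var (dec_index L i)) (embed_env L (look (ctx L) i))" by simp
    from rt_steps_lift[OF this, of e] e Def show ?thesis
      by (simp add: embed_env_Def del: dec_index.simps) simp
  next
    case Dec
    show ?thesis
    proof (cases i)
      case 0
      have "rt_steps nxt ((Dec, V) # L) 1 (Var 0) (lift 0 V)"
        by (rule rt_steps.step[OF rt_step.decl])
      \<comment> \<open>\<open>decl\<close> yields the raw entry \<open>V\<close>, whereas
        \<open>ctx\<close> records its interpretation; \<open>expand\<close> closes the gap.\<close>
      from rt_steps.trans[OF this rt_steps_lift[OF expand]] 0 e Dec show ?thesis
        by (simp add: lift_embed embed_ren)
    next
      case (Suc j)
      with Cons e Dec have "rt_steps nxt L 1 (Var (dec_index L j)) (embed_env L (look (ctx L) j))"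
        by (auto elim: head_declared_tailE)
      from rt_steps_lift[OF this, of e] e Dec Suc show ?thesis
        by (simp add: lift_embed embed_ren)
    qed
  qed
qed

lemma ty_rt_steps:
  "head_declared (ctx L) t \<Longrightarrow> rt_steps nxt L 1 (embed_env L t) (embed_env L (ty nxt (ctx L) t))"
proof (induction t arbitrary: L)
  case (LSort s)
  show ?case using rt_steps.step[OF rt_step.sort] by simp
next
  case (LVar i)
  then show ?case using head_declared_var_rt_steps by simp
next
  case (LApp v t)
  then show ?case by (auto elim!: head_declared_appE intro: rt_steps_app_fun)
next
  case (LLam w t)
  \<comment> \<open>Declaring the embedded domain makes \<open>ctx ?L\<close> equal to
    \<open>w # ctx L\<close>, by \<open>sem_embed\<close>.\<close>
  let ?L = "(Dec, embed_env L w) # L"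
  from LLam.prems have "head_declared (ctx ?L) t" by (auto elim: head_declared_lamE)
  from rt_steps_bind_body[OF LLam.IH(2)[OF this]] show ?case by simp
qed

lemma ty_pow_rt_steps:
  assumes "head_declared (ctx L) t"
  shows "rt_steps nxt L n (embed_env L t) (embed_env L ((ty nxt (ctx L) ^^ n) t))"
proof (induction n)
  case 0
  show ?case by (simp add: rt_steps.refl)
next
  case (Suc n)
  from rt_steps.trans[OF Suc ty_rt_steps[OF head_declared_ty_pow[OF assms]]] show ?case by simp
qed

text \<open>The weights add up to \<open>n\<close>: 0 for expansion, 1 for each \<open>ty\<close>,
  and 0 for safe reduction.\<close>

lemma cvalid_ty_rt_steps:
  assumes "cvalid nxt A L T" and "pars nxt (ctx L) ((ty nxt (ctx L) ^^ n) (sem L T)) u"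
  shows "rt_steps nxt L n T (embed_env L u)"
  using rt_steps_trans0[OF expand ty_pow_rt_steps[OF cvalid_head_declared[OF assms(1)]]]
    pars_rt_steps[OF assms(2)]
  by (metis rt_steps.trans add_0_right)

lemma cvalid_imp_valid: "cvalid nxt A L T \<Longrightarrow> valid nxt A L T"
proof (induction rule: cvalid.induct)
  case (cv_cast L U T)
  from conv_joinable[OF cv_cast.hyps(3)] obtain u
    where u: "pars nxt (ctx L) (ty nxt (ctx L) (sem L T)) u" "pars nxt (ctx L) (sem L U) u"
    by blast
  have "rt_steps nxt L 1 T (embed_env L u)"
    using cvalid_ty_rt_steps[OF cv_cast.hyps(2), of 1] u(1) by simp
  moreover have "rt_steps nxt L 0 U (embed_env L u)"
    using cvalid_ty_rt_steps[OF cv_cast.hyps(1), of 0] u(2) by simp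
  ultimately show ?case by (rule valid.cast[OF cv_cast.IH])
next
  case (cv_app L V T n w u)
  let ?G = "ctx L"
  from conv_joinable[OF cv_app.hyps(4)] obtain z
    where z: "pars nxt ?G ((ty nxt ?G ^^ n) (sem L T)) z" "pars nxt ?G (LLam w u) z" by blast
  from pars_lamD[OF z(2)] obtain w1 u1 where w1: "z = LLam w1 u1" "pars nxt ?G w w1" by blast
  \<comment> \<open>\<open>valid\<close> asks for one and the same domain on both sides: joining the
    domain \<open>w1\<close> of the function with the type of the argument gives \<open>w2\<close>,
    which both reach.\<close>
  have "conv nxt ?G (ty nxt ?G (sem L V)) w1"
    by (rule conv_trans[OF cv_app.hyps(5) pars_conv[OF w1(2)]])
  from conv_joinable[OF this] obtain w2
    where w2: "pars nxt ?G (ty nxt ?G (sem L V)) w2" "pars nxt ?G w1 w2" by blast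
  have "pars nxt ?G z (LLam w2 u1)"
    unfolding w1(1) by (rule pars_lam[OF w2(2) rtranclp.rtrancl_refl])
  with z(1) have "pars nxt ?G ((ty nxt ?G ^^ n) (sem L T)) (LLam w2 u1)" by simp
  from cvalid_ty_rt_steps[OF cv_app.hyps(2) this]
  have "rt_steps nxt L n T (Lam (embed_env L w2) (embed (upr (dec_index L)) u1))" by simp
  moreover have "rt_steps nxt L 1 V (embed_env L w2)"
    using cvalid_ty_rt_steps[OF cv_app.hyps(1), of 1] w2(1) by simp
  ultimately show ?case by (rule valid.app[OF cv_app.IH cv_app.hyps(3)])
qed (simp_all add: valid.intros)

theorem theorem5p4:
  fixes nxt :: "'s \<Rightarrow> 's" and A :: "nat set" and L :: "'s env" and T :: "'s trm"
  assumes "valid nxt A L T"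
  shows "\<exists>U. has_type nxt A L T U"
proof -
  have T: "cvalid nxt A L T" by (rule valid_imp_cvalid) fact
  from cvalid_type[OF T] obtain U where "cvalid nxt A L U"
    "conv nxt (ctx L) (ty nxt (ctx L) (sem L T)) (sem L U)" by blast
  with T have "cvalid nxt A L (Cast U T)" by (simp add: cv_cast)
  then show ?thesis unfolding has_type_def by (blast intro: cvalid_imp_valid)
qed

end
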